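(* Let $\mathbb{L}^D$ be the hypercube lattice, $d=2D$. Suppose $p_2>0$ and $D\ge2$. Then the limit $$\zeta(\mathbb{L}^D,{\bf p}):=\lim_{n\to\infty}\left\{\frac{-\log P_{\bf p}(|C|=n)}{n}\right\}\ge 0$$ exists, and if $\chi(\mathbb{L}^D,{\bf p})<\infty$, then $\zeta(\mathbb{L}^D,{\bf p})>0$. Moreover, $$P_{\bf p}(|C|=n)\le\frac{n}{a(d,{\bf p})}e^{-n\zeta(\mathbb{L}^D,{\bf p})}$$ for any $n\in\mathbb{N}$ (positive integers), where $$a(d,{\bf p})=\left(\frac{2p_2}{d(d-1)}\right)^3\left(\sum_{i=0}^{d-2}p_i\frac{(d-i)(d-i-1)}{d(d-1)}\right)^{2d-4}\left(\sum_{i=0}^{d-1}p_i\frac{d-i}{d}\right)^{d-4}.$$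
   Context: $\mathbb{L}^D=(V,E)$ is the directed graph with $V=\mathbb{Z}^D$, origin $o=0$, and $(x,y)\in E$ iff $\|x-y\|=1$ (Euclidean norm); it is $d$-regular with $d=2D$. Let $L_x=\{y:(x,y)\in E\}$. Let ${\bf p}=(p_0,\dots,p_d)$ with $p_i\ge0$ and $\sum_i p_i=1$. Configurations are $\omega\in\Omega=\prod_{x\in V}2^{L_x}$ with the $\sigma$-field generated by finite-dimensional cylinders; $P_{\bf p}$ is the product measure under which the states $\omega(x)\subset L_x$ are independent with $P_{\bf p}(\omega(x)=S)=p_{|S|}/\binom{d}{|S|}$ for $S\subset L_x$. Put $E_\omega=\{(x,y):y\in\omega(x)\}$. Vertices $x,y$ are weakly connected if $x=y$ or there are $x=z_0,\dots,z_m=y$ such that for each $i$, $(z_i,z_{i+1})\in E_\omega$ or $(z_{i+1},z_i)\in E_\omega$. $|C|$ is the number of vertices weakly connected to $o$, and $\chi(\mathbb{L}^D,{\bf p})=\mathbb{E}_{\bf p}(|C|)$. Convention: $-\log 0=+\infty$. *)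

theory Defs
  imports "HOL-Probability.Probability"
begin

type_synonym 'n vertex = "int ^ 'n"
type_synonym 'n config = "'n vertex \<Rightarrow> 'n vertex set"

text \<open>The dimension D of the lattice is \<open>CARD('n)\<close>. Integer vectors carry no norm in the library,
  so adjacency is expressed by the Euclidean norm of the difference viewed as a real vector.\<close>

definition lattice_edges :: "('n::finite vertex \<times> 'n vertex) set" where
  "lattice_edges = {(x, y). norm (\<chi> i. real_of_int (x $ i - y $ i)) = 1}"

definition nbrs :: "'n::finite vertex \<Rightarrow> 'n vertex set" where
  "nbrs x = {y. (x, y) \<in> lattice_edges}"

definition lattice_degree :: "'n::finite itself \<Rightarrow> nat" where
  "lattice_degree _ = 2 * CARD('n)"

definition state_measure :: "(nat \<Rightarrow> real) \<Rightarrow> 'n::finite vertex \<Rightarrow> 'n vertex set measure" where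
  "state_measure p x =
     point_measure (Pow (nbrs x))
       (\<lambda>S. ennreal (p (card S) / real (lattice_degree TYPE('n) choose card S)))"

definition config_measure :: "(nat \<Rightarrow> real) \<Rightarrow> 'n::finite config measure" where
  "config_measure p = PiM UNIV (state_measure p)"

definition open_edges :: "'n::finite config \<Rightarrow> ('n vertex \<times> 'n vertex) set" where
  "open_edges \<omega> = {(x, y). y \<in> \<omega> x}"

definition weakly_connected :: "'n::finite config \<Rightarrow> 'n vertex \<Rightarrow> 'n vertex \<Rightarrow> bool" where
  "weakly_connected \<omega> x y \<longleftrightarrow> (x, y) \<in> (open_edges \<omega> \<union> (open_edges \<omega>)\<inverse>)\<^sup>*"

definition origin_cluster :: "'n::finite config \<Rightarrow> 'n vertex set" where
  "origin_cluster \<omega> = {y. weakly_connected \<omega> 0 y}"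

definition cluster_size :: "'n::finite config \<Rightarrow> enat" where
  "cluster_size \<omega> =
     (if finite (origin_cluster \<omega>) then enat (card (origin_cluster \<omega>)) else \<infinity>)"

text \<open>In the next two definitions the lattice dimension occurs only as a type, hence the
  \<open>itself\<close> argument.\<close>

definition cluster_size_prob :: "'n::finite itself \<Rightarrow> (nat \<Rightarrow> real) \<Rightarrow> nat \<Rightarrow> real" where
  "cluster_size_prob _ p n =
     measure (config_measure p :: 'n config measure)
       {\<omega> \<in> space (config_measure p). cluster_size \<omega> = enat n}"

definition mean_cluster_size :: "'n::finite itself \<Rightarrow> (nat \<Rightarrow> real) \<Rightarrow> ennreal" where
  "mean_cluster_size _ p =
     (\<integral>\<^sup>+ \<omega>. ennreal_of_enat (cluster_size \<omega>) \<partial>(config_measure p :: 'n config measure))"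

text \<open>Needed because \<open>ln 0 = 0\<close> in the library.\<close>

definition neg_log :: "real \<Rightarrow> ereal" where
  "neg_log x = (if x = 0 then \<infinity> else ereal (- ln x))"

text \<open>For \<open>d \<ge> 4\<close> the natural-number subtractions in the exponents are exact.\<close>

definition a_const :: "nat \<Rightarrow> (nat \<Rightarrow> real) \<Rightarrow> real" where
  "a_const d p =
     (2 * p 2 / (real d * (real d - 1))) ^ 3 *
     (\<Sum>i=0..d - 2. p i * ((real d - real i) * (real d - real i - 1) / (real d * (real d - 1))))
       ^ (2 * d - 4) *
     (\<Sum>i=0..d - 1. p i * ((real d - real i) / real d)) ^ (d - 4)"

end

theory Submission
  imports Defs "HOL-Real_Asymp.Real_Asymp"
begin

text \<open>Write \<open>f(A)\<close> for the probability that \<open>A\<close> is a cluster. If \<open>A\<close> and \<open>B\<close> are separated by a slab of width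
  \<open>k \<ge> 2\<close> orthogonal to a coordinate axis, then giving the \<open>k\<close> vertices of a straight path across the slab the
  state consisting of their two neighbours along the path, and letting the vertices beside the path avoid the
  union, yields \<open>f(A \<union> path \<union> B) \<ge> c\<^sub>k f(A) f(B)\<close>. The two pieces can be recovered from the union and their sizes,
  so \<open>P(|C| = n) / n\<close> is supermultiplicative up to \<open>c\<^sub>2\<close> and the shift \<open>2\<close>, and Fekete's lemma gives the limit and
  the upper bound with \<open>c\<^sub>2 \<ge> a(d, p)\<close>. Joining two unit squares by longer paths shows that every size \<open>n \<ge> 10\<close> has
  positive probability.

  For the strict positivity, explore the cluster \<open>D\<close> of the origin using only
  the states in a large box. If \<open>D\<close> leaves the box, then the full cluster is covered by the clusters started
  from the vertices within distance \<open>2\<close> of \<open>D\<close> that use only states at vertices not adjacent to \<open>D\<close>, and these are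
  independent of \<open>D\<close>. The expected number of starting points is at most a constant times \<open>E(|C|; |C| > r)\<close>,
  which is small if the mean cluster size is finite; iterating, the radius of the cluster has an exponential tail. A
  cluster of size \<open>n\<close> then contains order \<open>n\<close> well-separated vertices from which independent unlikely escapes
  occur, and these vertices can be visited by a walk with bounded steps, so a union bound over walks
  gives exponential decay of \<open>P(|C| = n)\<close>.\<close>

section \<open>Lattice geometry and local clusters\<close>

text \<open>Balls of the sup norm: one lattice step stays within radius 1 and radii add, so later
  distance estimates are additions of natural numbers.\<close>

definition cube :: "'n::finite vertex \<Rightarrow> nat \<Rightarrow> 'n vertex set" where
  "cube x r = {y. \<forall>i. \<bar>y $ i - x $ i\<bar> \<le> int r}"

text \<open>Squared distances of lattice points are sums of squares of integers; such a sum equals 1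
  only if one term is 1 and all others vanish.\<close>

lemma nbrs_eq:
  fixes x :: "'n::finite vertex"
  shows "nbrs x = (\<lambda>(i, s). x + axis i s) ` (UNIV \<times> {1, -1})"
proof -
  have "norm (\<chi> i. real_of_int (x $ i - y $ i)) = 1 \<longleftrightarrow> y \<in> (\<lambda>(i, s). x + axis i s) ` (UNIV \<times> {1, -1})" for y
  proof -
    have "norm (\<chi> i. real_of_int (x $ i - y $ i)) = sqrt (real_of_int (\<Sum>i\<in>UNIV. (x $ i - y $ i)\<^sup>2))"
      by (simp add: norm_vec_def L2_set_def)
    then have n1: "norm (\<chi> i. real_of_int (x $ i - y $ i)) = 1 \<longleftrightarrow> (\<Sum>i\<in>UNIV. (x $ i - y $ i)\<^sup>2) = 1"
      by (simp add: real_sqrt_eq_1_iff del: of_int_sum of_int_power)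
    show ?thesis unfolding n1
    proof
      assume s1: "(\<Sum>i\<in>UNIV. (x $ i - y $ i)\<^sup>2) = 1"
      have "\<exists>i. (x $ i - y $ i)\<^sup>2 \<noteq> 0"
      proof (rule ccontr)
        assume "\<not> ?thesis"
        then have "(\<Sum>i\<in>UNIV. (x $ i - y $ i)\<^sup>2) = 0" by (intro sum.neutral) auto
        then show False using s1 by simp
      qed
      then obtain i where i: "(x $ i - y $ i)\<^sup>2 \<noteq> 0" by blast
      then have i1: "(x $ i - y $ i)\<^sup>2 \<ge> 1"
        by (smt (verit) zero_le_power2)
      have "(\<Sum>j\<in>UNIV. (x $ j - y $ j)\<^sup>2) = (x $ i - y $ i)\<^sup>2 + (\<Sum>j\<in>UNIV-{i}. (x $ j - y $ j)\<^sup>2)"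
        by (simp add: sum.remove)
      moreover have "(\<Sum>j\<in>UNIV-{i}. (x $ j - y $ j)\<^sup>2) \<ge> 0" by (simp add: sum_nonneg)
      ultimately have e: "(x $ i - y $ i)\<^sup>2 = 1" "(\<Sum>j\<in>UNIV-{i}. (x $ j - y $ j)\<^sup>2) = 0"
        using s1 i1 by linarith+
      have z: "x $ j = y $ j" if "j \<noteq> i" for j
        using e(2) that by (subst (asm) sum_nonneg_eq_0_iff) auto
      from e(1) have "y $ i - x $ i = 1 \<or> y $ i - x $ i = -1"
        by (metis minus_diff_eq power2_eq_1_iff minus_equation_iff)
      then obtain s where s: "s \<in> {1,-1}" "y $ i = x $ i + s" by auto
      have "y = x + axis i s"
        using z s by (auto simp: vec_eq_iff axis_def)
      then show "y \<in> (\<lambda>(i, s). x + axis i s) ` (UNIV \<times> {1, -1})" using s by auto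
    next
      assume "y \<in> (\<lambda>(i, s). x + axis i s) ` (UNIV \<times> {1, -1})"
      then obtain i s where s: "s \<in> {1,-1}" "y = x + axis i s" by auto
      have "(\<Sum>j\<in>UNIV. (x $ j - y $ j)\<^sup>2) = (\<Sum>j\<in>UNIV. if j = i then 1 else 0)"
        using s by (intro sum.cong) (auto simp: axis_def)
      then show "(\<Sum>j\<in>UNIV. (x $ j - y $ j)\<^sup>2) = 1" by simp
    qed
  qed
  then show ?thesis by (auto simp: nbrs_def lattice_edges_def)
qed

lemma nbrs_cases:
  assumes "y \<in> nbrs x"
  obtains i s where "s = 1 \<or> s = -1" "y = x + axis i s"
  using assms unfolding nbrs_eq by auto

lemma nbrsI: "s = 1 \<or> s = -1 \<Longrightarrow> x + axis i s \<in> nbrs x"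
  unfolding nbrs_eq by auto

lemma axis_uminus: "axis i (- s) = - axis i (s::int)"
  by (simp add: vec_eq_iff axis_def)

lemma finite_nbrs [simp]: "finite (nbrs x)"
  unfolding nbrs_eq by simp

lemma card_nbrs: "card (nbrs (x :: 'n::finite vertex)) = lattice_degree TYPE('n)"
proof -
  have "inj_on (\<lambda>(i, s). x + axis i s) (UNIV \<times> {1, -1})"
    by (rule inj_onI) (auto simp: axis_eq_axis)
  then have "card (nbrs x) = card ((UNIV :: 'n set) \<times> {1, -1 :: int})"
    unfolding nbrs_eq by (simp add: card_image)
  then show ?thesis by (simp add: card_cartesian_product lattice_degree_def)
qed

lemma nbrs_sym: "y \<in> nbrs x \<longleftrightarrow> x \<in> nbrs y"
  by (simp add: nbrs_def lattice_edges_def norm_vec_def L2_set_def power2_commute)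

lemma nbrs_add: "nbrs (t + x) = (+) t ` nbrs x"
  unfolding nbrs_eq image_image by (intro image_cong refl) (auto simp: add.assoc)

lemma nbrs_subset_cube: "nbrs x \<subseteq> cube x 1"
  by (auto elim!: nbrs_cases simp: cube_def axis_def)

lemma nbrs_coord: "y \<in> nbrs x \<Longrightarrow> \<bar>y $ i - x $ i\<bar> \<le> 1"
  using nbrs_subset_cube[of x] by (auto simp: cube_def)

lemma cube_self [simp]: "x \<in> cube x r"
  by (simp add: cube_def)

lemma cube_triangle:
  assumes "y \<in> cube x r" "z \<in> cube y s" shows "z \<in> cube x (r + s)"
proof -
  have "\<bar>z $ i - x $ i\<bar> \<le> int (r + s)" for i
  proof -
    have "\<bar>y $ i - x $ i\<bar> \<le> int r" "\<bar>z $ i - y $ i\<bar> \<le> int s"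
      using assms by (auto simp: cube_def)
    then show ?thesis by linarith
  qed
  then show ?thesis by (simp add: cube_def)
qed

lemma cube_sym: "y \<in> cube x r \<longleftrightarrow> x \<in> cube y r"
  by (simp add: cube_def abs_minus_commute)

lemma cube_mono: "r \<le> s \<Longrightarrow> cube x r \<subseteq> cube x s"
  by (auto simp: cube_def intro: order_trans)

lemma cube_add: "cube (t + x) r = (+) t ` cube x r"
proof -
  have "y \<in> (+) t ` cube x r" if "y \<in> cube (t + x) r" for y
    using that by (intro image_eqI[of _ _ "y - t"]) (auto simp: cube_def algebra_simps)
  then show ?thesis by (auto simp: cube_def)
qed

text \<open>Polynomial volume growth, which in the end is set against the exponential decay of
  \<open>escape_prob\<close>.\<close>

lemma card_cube_le: "finite (cube (x :: 'n::finite vertex) r) \<and> card (cube x r) \<le> (2 * r + 1) ^ CARD('n)"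
proof -
  let ?P = "PiE (UNIV::'n set) (\<lambda>i. {x $ i - int r..x $ i + int r})"
  have f: "finite ?P" by (intro finite_PiE) auto
  have "cube x r \<subseteq> vec_lambda ` ?P"
  proof
    fix y assume "y \<in> cube x r"
    then have "vec_nth y \<in> ?P" by (auto simp: cube_def abs_le_iff algebra_simps)
    then show "y \<in> vec_lambda ` ?P" by (intro image_eqI[of _ _ "vec_nth y"]) (simp_all add: vec_nth_inverse)
  qed
  moreover have "card ?P = (2 * r + 1) ^ CARD('n)"
    by (subst card_PiE) (auto simp: nat_add_distrib nat_mult_distrib)
  ultimately show ?thesis
    using f card_image_le[OF f, of vec_lambda] card_mono[of "vec_lambda ` ?P" "cube x r"] finite_subset[of "cube x r" "vec_lambda ` ?P"]
    by auto
qed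

lemma finite_cube [simp]: "finite (cube x r)"
  using card_cube_le by blast

lemma card_cube_eq: "card (cube (x :: 'n::finite vertex) r) = card (cube (0 :: 'n vertex) r)"
  using cube_add[of x 0 r] by (simp add: card_image)

section \<open>Neighbourhoods and clusters explored with the states of a given vertex set\<close>

definition nbhd :: "'n::finite vertex set \<Rightarrow> 'n vertex set" where
  "nbhd A = A \<union> (\<Union>x\<in>A. nbrs x)"

lemma finite_nbhd [simp]: "finite A \<Longrightarrow> finite (nbhd A)"
  by (simp add: nbhd_def)

definition legal :: "'n::finite config \<Rightarrow> bool" where
  "legal \<omega> \<longleftrightarrow> (\<forall>x. \<omega> x \<subseteq> nbrs x)"

text \<open>An edge counts if the state of an endpoint in \<open>F\<close> selects it; the other
  endpoint may lie outside \<open>F\<close>. Hence \<open>cluster_in F\<close> reads only states in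
  \<open>F\<close> but can reach vertices beyond it.\<close>

definition local_edges :: "'n::finite vertex set \<Rightarrow> 'n config \<Rightarrow> ('n vertex \<times> 'n vertex) set" where
  "local_edges F \<omega> = {(a, b). (a \<in> F \<and> b \<in> \<omega> a) \<or> (b \<in> F \<and> a \<in> \<omega> b)}"

definition cluster_in :: "'n::finite vertex set \<Rightarrow> 'n config \<Rightarrow> 'n vertex \<Rightarrow> 'n vertex set" where
  "cluster_in F \<omega> x = {y. (x, y) \<in> (local_edges F \<omega>)\<^sup>*}"

lemma origin_cluster_eq: "origin_cluster \<omega> = cluster_in UNIV \<omega> 0"
proof -
  have "open_edges \<omega> \<union> (open_edges \<omega>)\<inverse> = local_edges UNIV \<omega>"
    by (auto simp: open_edges_def local_edges_def)
  then show ?thesis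
    by (simp add: origin_cluster_def weakly_connected_def cluster_in_def)
qed

lemma local_edges_nbrs: "legal \<omega> \<Longrightarrow> (a, b) \<in> local_edges F \<omega> \<Longrightarrow> b \<in> nbrs a"
  unfolding local_edges_def legal_def using nbrs_sym[of b a] by auto

lemma local_edges_mono: "F \<subseteq> G \<Longrightarrow> local_edges F \<omega> \<subseteq> local_edges G \<omega>"
  by (auto simp: local_edges_def)

lemma cluster_in_self [simp]: "x \<in> cluster_in F \<omega> x"
  by (simp add: cluster_in_def)

lemma cluster_in_step: "a \<in> cluster_in F \<omega> x \<Longrightarrow> (a, b) \<in> local_edges F \<omega> \<Longrightarrow> b \<in> cluster_in F \<omega> x"
  by (auto simp: cluster_in_def intro: rtrancl_into_rtrancl)

lemma cluster_in_subset:
  assumes "x \<in> H" "\<And>a b. a \<in> H \<Longrightarrow> (a, b) \<in> local_edges F \<omega> \<Longrightarrow> b \<in> H"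
  shows "cluster_in F \<omega> x \<subseteq> H"
proof -
  have "y \<in> H" if "(x, y) \<in> (local_edges F \<omega>)\<^sup>*" for y
    using that by induction (use assms in auto)
  then show ?thesis by (auto simp: cluster_in_def)
qed

lemma cluster_in_mono: "F \<subseteq> G \<Longrightarrow> cluster_in F \<omega> x \<subseteq> cluster_in G \<omega> x"
  unfolding cluster_in_def using rtrancl_mono[OF local_edges_mono] by blast

lemma cluster_in_trans: "y \<in> cluster_in F \<omega> x \<Longrightarrow> cluster_in F \<omega> y \<subseteq> cluster_in F \<omega> x"
  by (auto simp: cluster_in_def)

lemma cluster_in_sym: "y \<in> cluster_in F \<omega> x \<Longrightarrow> x \<in> cluster_in F \<omega> y"
proof -
  have "sym (local_edges F \<omega>)" by (auto simp: sym_def local_edges_def)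
  then have "sym ((local_edges F \<omega>)\<^sup>*)" by (rule sym_rtrancl)
  then show "y \<in> cluster_in F \<omega> x \<Longrightarrow> x \<in> cluster_in F \<omega> y"
    by (auto simp: cluster_in_def dest: symD)
qed

lemma cluster_in_eq: "y \<in> cluster_in F \<omega> x \<Longrightarrow> cluster_in F \<omega> y = cluster_in F \<omega> x"
  by (meson cluster_in_sym cluster_in_trans subset_antisym)

lemma cluster_in_cong:
  assumes "\<And>w. w \<in> F \<Longrightarrow> \<omega> w = \<omega>' w"
  shows "cluster_in F \<omega> x = cluster_in F \<omega>' x"
proof -
  have "local_edges F \<omega> = local_edges F \<omega>'" using assms by (auto simp: local_edges_def)
  then show ?thesis by (simp add: cluster_in_def)
qed

text \<open>Whether the exploration ends with exactly \<open>A\<close> is decided by the states in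
  \<open>A\<close> and by those adjacent to \<open>A\<close>, which could add edges into
  \<open>A\<close>. For finite \<open>A\<close> this makes the event finite-dimensional.\<close>

lemma cluster_in_determined:
  assumes "legal \<omega>" "legal \<omega>'" "\<And>w. w \<in> F \<inter> nbhd A \<Longrightarrow> \<omega> w = \<omega>' w"
    and C: "cluster_in F \<omega> x = A"
  shows "cluster_in F \<omega>' x = A"
proof -
  have e: "(a, b) \<in> local_edges F \<omega> \<longleftrightarrow> (a, b) \<in> local_edges F \<omega>'" if "a \<in> A" for a b
  proof -
    have "(a, b) \<in> local_edges F \<omega> \<longleftrightarrow> (a, b) \<in> local_edges F \<omega>'" if "b \<in> nbrs a"
    proof -
      have "a \<in> nbhd A" "b \<in> nbhd A" using that \<open>a \<in> A\<close> by (auto simp: nbhd_def)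
      then show ?thesis using assms(3) by (auto simp: local_edges_def)
    qed
    then show ?thesis using local_edges_nbrs assms(1,2) by blast
  qed
  have "x \<in> A" using C cluster_in_self by blast
  have "cluster_in F \<omega>' x \<subseteq> A"
  proof (rule cluster_in_subset)
    fix a b assume "a \<in> A" "(a, b) \<in> local_edges F \<omega>'"
    then show "b \<in> A" using C e cluster_in_step by blast
  qed fact
  \<comment> \<open>Membership in \<open>A\<close> is carried along because the two edge relations
    are known to agree only at vertices of \<open>A\<close>.\<close>
  moreover have "cluster_in F \<omega> x \<subseteq> A \<inter> cluster_in F \<omega>' x"
  proof (rule cluster_in_subset)
    fix a b assume a: "a \<in> A \<inter> cluster_in F \<omega>' x" and ab: "(a, b) \<in> local_edges F \<omega>"
    then have "b \<in> A" using C cluster_in_step by blast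
    moreover have "b \<in> cluster_in F \<omega>' x" using a ab e cluster_in_step by blast
    ultimately show "b \<in> A \<inter> cluster_in F \<omega>' x" by blast
  qed (use \<open>x \<in> A\<close> in auto)
  ultimately show ?thesis using C by auto
qed

text \<open>If the exploration with states up to radius \<open>Suc l\<close> stayed in
  \<open>cube v l\<close>, it would be closed under all edges of \<open>F\<close>, since an edge
  starting in \<open>cube v l\<close> has both endpoints in \<open>cube v (Suc l)\<close>.\<close>

lemma not_in_cube_local:
  assumes "legal \<omega>" "\<not> cluster_in F \<omega> v \<subseteq> cube v l"
  shows "\<not> cluster_in (F \<inter> cube v (Suc l)) \<omega> v \<subseteq> cube v l"
proof
  let ?C = "cluster_in (F \<inter> cube v (Suc l)) \<omega> v"
  assume s: "?C \<subseteq> cube v l"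
  have "cluster_in F \<omega> v \<subseteq> ?C"
  proof (rule cluster_in_subset)
    fix a b assume a: "a \<in> ?C" and ab: "(a, b) \<in> local_edges F \<omega>"
    have "b \<in> cube a 1" using ab assms(1) local_edges_nbrs nbrs_subset_cube by blast
    then have "a \<in> cube v (Suc l)" "b \<in> cube v (Suc l)"
      using a s cube_triangle[of a v l b 1] cube_mono[of l "Suc l" v] by auto
    then have "(a, b) \<in> local_edges (F \<inter> cube v (Suc l)) \<omega>"
      using ab by (auto simp: local_edges_def)
    then show "b \<in> ?C" using a cluster_in_step by blast
  qed auto
  then show False using assms(2) s by blast
qed

lemma cluster_in_cube_subset:
  assumes "legal \<omega>" shows "cluster_in (cube v r) \<omega> v \<subseteq> cube v (Suc r)"
proof (rule cluster_in_subset)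
  fix a b assume ab: "(a, b) \<in> local_edges (cube v r) \<omega>"
  then have "b \<in> cube a 1" using assms local_edges_nbrs nbrs_subset_cube by blast
  then show "b \<in> cube v (Suc r)"
    using ab cube_triangle[of a v r b 1] cube_mono[of r "Suc r" v] by (auto simp: local_edges_def)
qed auto

text \<open>Each radius \<open>0, ..., r + 1\<close> contributes a new vertex: a cluster that gains
  nothing from one cube to the next is closed under its edges and stays in the smaller cube.\<close>

lemma card_cluster_ge:
  assumes "legal \<omega>" "finite (cluster_in F \<omega> x)" "\<not> cluster_in F \<omega> x \<subseteq> cube x r"
  shows "card (cluster_in F \<omega> x) \<ge> r + 2"
proof -
  let ?C = "cluster_in F \<omega> x"
  have j: "card (?C \<inter> cube x j) \<ge> j + 1" if "j \<le> Suc r" for j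
    using that
  proof (induction j)
    case 0
    have "x \<in> ?C \<inter> cube x 0" by simp
    then show ?case using assms(2) by (auto simp: Suc_le_eq card_gt_0_iff simp del: cluster_in_self cube_self)
  next
    case (Suc j)
    have "?C \<inter> cube x j \<noteq> ?C \<inter> cube x (Suc j)"
    proof
      assume eq: "?C \<inter> cube x j = ?C \<inter> cube x (Suc j)"
      have "?C \<subseteq> ?C \<inter> cube x j"
      proof (rule cluster_in_subset)
        fix a b assume a: "a \<in> ?C \<inter> cube x j" and ab: "(a, b) \<in> local_edges F \<omega>"
        have "b \<in> cube a 1" using ab assms(1) local_edges_nbrs nbrs_subset_cube by blast
        then have "b \<in> cube x (Suc j)" using a cube_triangle[of a x j b 1] by auto
        then show "b \<in> ?C \<inter> cube x j" using a ab cluster_in_step eq by blast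
      qed auto
      then show False using assms(3) Suc.prems cube_mono[of j r x] by auto
    qed
    then have "?C \<inter> cube x j \<subset> ?C \<inter> cube x (Suc j)" using cube_mono[of j "Suc j" x] by auto
    then have "card (?C \<inter> cube x j) < card (?C \<inter> cube x (Suc j))"
      by (intro psubset_card_mono) auto
    then show ?case using Suc by auto
  qed
  have "card (?C \<inter> cube x (Suc r)) \<le> card ?C" by (intro card_mono assms) auto
  then show ?thesis using j[of "Suc r"] by auto
qed

section \<open>Translations of configurations\<close>

definition translate :: "'n::finite vertex \<Rightarrow> 'n config \<Rightarrow> 'n config" where
  "translate t \<omega> = (\<lambda>x. (+) t ` \<omega> (x - t))"

lemma legal_translate: "legal \<omega> \<Longrightarrow> legal (translate t \<omega>)"
  unfolding legal_def translate_def
proof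
  fix x assume "\<forall>x. \<omega> x \<subseteq> nbrs x"
  then have "(+) t ` \<omega> (x - t) \<subseteq> (+) t ` nbrs (x - t)" by blast
  also have "\<dots> = nbrs x" using nbrs_add[of t "x - t"] by simp
  finally show "(+) t ` \<omega> (x - t) \<subseteq> nbrs x" .
qed

lemma local_edges_translate:
  "(t + a, t + b) \<in> local_edges ((+) t ` F) (translate t \<omega>) \<longleftrightarrow> (a, b) \<in> local_edges F \<omega>"
  by (auto simp: local_edges_def translate_def inj_image_mem_iff)

lemma cluster_in_translate:
  "cluster_in ((+) t ` F) (translate t \<omega>) (t + x) = (+) t ` cluster_in F \<omega> x"
proof
  show "cluster_in ((+) t ` F) (translate t \<omega>) (t + x) \<subseteq> (+) t ` cluster_in F \<omega> x"
  proof (rule cluster_in_subset)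
    fix a b assume "a \<in> (+) t ` cluster_in F \<omega> x" "(a, b) \<in> local_edges ((+) t ` F) (translate t \<omega>)"
    then obtain a' where "a' \<in> cluster_in F \<omega> x" "(t + a', t + (b - t)) \<in> local_edges ((+) t ` F) (translate t \<omega>)"
      by auto
    then have "b - t \<in> cluster_in F \<omega> x" unfolding local_edges_translate using cluster_in_step by blast
    then show "b \<in> (+) t ` cluster_in F \<omega> x" by (metis add_diff_cancel_left' diff_add_cancel add.commute image_eqI)
  qed auto
  have "cluster_in F \<omega> x \<subseteq> {y. t + y \<in> cluster_in ((+) t ` F) (translate t \<omega>) (t + x)}"
    by (rule cluster_in_subset) (auto intro: cluster_in_step simp: local_edges_translate)
  then show "(+) t ` cluster_in F \<omega> x \<subseteq> cluster_in ((+) t ` F) (translate t \<omega>) (t + x)" by auto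
qed

section \<open>The configuration space\<close>

lemma sum_Pow_card:
  fixes g :: "nat \<Rightarrow> real"
  assumes "finite X"
  shows "(\<Sum>S\<in>Pow X. g (card S)) = (\<Sum>i\<le>card X. real (card X choose i) * g i)"
proof -
  have "(\<Sum>S\<in>Pow X. g (card S)) = (\<Sum>i\<le>card X. \<Sum>S\<in>{S\<in>Pow X. card S = i}. g (card S))"
    using assms by (intro sum.group[symmetric]) (auto intro: card_mono)
  also have "\<dots> = (\<Sum>i\<le>card X. real (card X choose i) * g i)"
  proof (rule sum.cong[OF refl])
    fix i
    have "card {S \<in> Pow X. card S = i} = card X choose i"
      using n_subsets[OF assms, of i] by simp
    then show "(\<Sum>S\<in>{S\<in>Pow X. card S = i}. g (card S)) = real (card X choose i) * g i"
      by simp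
  qed
  finally show ?thesis .
qed

text \<open>The ratio is the probability that a uniform subset of size \<open>i\<close> misses a
  given one of \<open>d\<close> points; \<open>choose_ratio2\<close> is the analogue for two points.
  They identify \<open>avoid 1\<close> and \<open>avoid 2\<close> with the sums in
  \<open>a_const\<close>.\<close>

lemma choose_ratio1:
  assumes "i < d"
  shows "real (d - 1 choose i) / real (d choose i) = (real d - real i) / real d"
proof -
  obtain e where e: "d = Suc e" using assms by (cases d) auto
  have "(Suc e - i) * (Suc e choose i) = Suc e * (e choose i)"
    using binomial_absorb_comp[of "Suc e" i] by simp
  then have "(real d - real i) * real (d choose i) = real d * real (d - 1 choose i)"
    using assms e by (metis diff_Suc_1 less_imp_le of_nat_diff of_nat_mult)
  moreover have "d choose i > 0" using assms by simp
  ultimately show ?thesis using assms by (simp add: field_simps)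
qed

lemma choose_ratio2:
  assumes "i + 1 < d"
  shows "real (d - 2 choose i) / real (d choose i)
    = (real d - real i) * (real d - real i - 1) / (real d * (real d - 1))"
proof -
  have "real (d - 2 choose i) / real (d choose i)
      = (real (d - 1 - 1 choose i) / real (d - 1 choose i)) * (real (d - 1 choose i) / real (d choose i))"
    using assms by (simp add: numeral_2_eq_2)
  also have "\<dots> = ((real (d - 1) - real i) / real (d - 1)) * ((real d - real i) / real d)"
    using assms by (subst (1 2) choose_ratio1) auto
  finally show ?thesis using assms by (simp add: of_nat_diff field_simps)
qed

section \<open>The law of the state at a single vertex\<close>

locale degenerate_environment =
  fixes p :: "nat \<Rightarrow> real" and d :: nat and lat :: "'n::finite itself"
  assumes d_def: "d = lattice_degree TYPE('n)"
    and dim: "CARD('n) \<ge> 2"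
    and p_nonneg: "\<And>i. i \<le> d \<Longrightarrow> p i \<ge> 0"
    and p_sum: "(\<Sum>i=0..d. p i) = 1"
    and p2_pos: "p 2 > 0"
begin

abbreviation P :: "'n config measure" where "P \<equiv> config_measure p"

definition weight :: "nat \<Rightarrow> real" where
  "weight i = p i / real (d choose i)"

text \<open>The probability that a vertex selects none of \<open>t\<close> given neighbours, as
  \<open>measure_state_avoid\<close> confirms.\<close>

definition avoid :: "nat \<Rightarrow> real" where
  "avoid t = (\<Sum>i\<le>d - t. real (d - t choose i) * weight i)"

lemma d_ge: "d \<ge> 4"
  using d_def dim by (simp add: lattice_degree_def)

lemma card_nbrs_d: "card (nbrs (x :: 'n vertex)) = d"
  by (simp add: card_nbrs d_def)

lemma weight_nonneg: "i \<le> d \<Longrightarrow> weight i \<ge> 0"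
  by (simp add: weight_def p_nonneg)

lemma measure_state:
  assumes "Y \<subseteq> Pow (nbrs (x :: 'n vertex))"
  shows "measure (state_measure p x) Y = (\<Sum>S\<in>Y. weight (card S))"
proof -
  have "card S \<le> d" if "S \<subseteq> nbrs x" for S
    using card_mono[OF finite_nbrs that] by (simp add: card_nbrs_d)
  then show ?thesis
    using assms weight_nonneg
    by (simp add: state_measure_def Sigma_Algebra.measure_def emeasure_point_measure_finite weight_def
        d_def[symmetric] sum_nonneg subset_eq)
qed

lemma measure_state_avoid:
  assumes "S \<subseteq> nbrs (x :: 'n vertex)"
  shows "measure (state_measure p x) {T \<in> Pow (nbrs x). T \<inter> S = {}} = avoid (card S)"
proof -
  have "{T \<in> Pow (nbrs x). T \<inter> S = {}} = Pow (nbrs x - S)" by auto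
  moreover have "card (nbrs x - S) = d - card S"
    using assms by (simp add: card_Diff_subset finite_subset card_nbrs_d)
  ultimately show ?thesis
    by (simp add: measure_state sum_Pow_card[of _ weight] avoid_def Pow_mono)
qed

lemma avoid_0: "avoid 0 = 1"
proof -
  have "avoid 0 = (\<Sum>i\<le>d. p i)"
    unfolding avoid_def weight_def by (intro sum.cong) auto
  then show ?thesis using p_sum by (simp add: atMost_atLeast0)
qed

lemma prob_space_state: "prob_space (state_measure p (x :: 'n vertex))"
proof
  have "measure (state_measure p x) (Pow (nbrs x)) = 1"
    using measure_state_avoid[of "{}" x] avoid_0 by (simp add: Pow_def)
  moreover have "space (state_measure p x) = Pow (nbrs x)"
    by (simp add: state_measure_def space_point_measure)
  moreover have "emeasure (state_measure p x) (Pow (nbrs x)) < \<infinity>"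
    by (simp add: state_measure_def emeasure_point_measure_finite)
  ultimately show "emeasure (state_measure p x) (space (state_measure p x)) = 1"
    by (simp add: emeasure_eq_ennreal_measure)
qed

sublocale product_prob_space "state_measure p :: 'n vertex \<Rightarrow> _" UNIV
  by (intro product_prob_space.intro product_sigma_finite.intro product_prob_space_axioms.intro
      prob_space_imp_sigma_finite prob_space_state)

sublocale prob_space P
  unfolding config_measure_def by (rule P.prob_space_axioms)

lemma sets_state: "sets (state_measure p (x :: 'n vertex)) = Pow (Pow (nbrs x))"
  by (simp add: state_measure_def sets_point_measure)

lemma space_P: "space P = {\<omega>. legal \<omega>}"
  by (auto simp: config_measure_def space_PiM state_measure_def space_point_measure legal_def PiE_def Pi_def)

text \<open>Read through \<open>measure_state_avoid\<close>, this is monotonicity of measure: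
  missing a larger set of neighbours is a smaller event.\<close>

lemma avoid_antimono:
  assumes "s \<le> t" "t \<le> d" shows "avoid t \<le> avoid s"
proof -
  obtain U where U: "U \<subseteq> nbrs (0 :: 'n vertex)" "card U = t"
    using obtain_subset_with_card_n[of t "nbrs (0 :: 'n vertex)"] assms by (auto simp: card_nbrs_d)
  then obtain S where S: "S \<subseteq> U" "card S = s"
    using obtain_subset_with_card_n[of s U] assms by auto
  have "avoid t = measure (state_measure p 0) {T \<in> Pow (nbrs (0 :: 'n vertex)). T \<inter> U = {}}"
    using measure_state_avoid[OF U(1)] U(2) by simp
  also have "\<dots> \<le> measure (state_measure p 0) {T \<in> Pow (nbrs (0 :: 'n vertex)). T \<inter> S = {}}"
    using S by (intro M.finite_measure_mono) (auto simp: sets_state)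
  also have "\<dots> = avoid s" using U S by (subst measure_state_avoid) auto
  finally show ?thesis .
qed

lemma avoid_le_1: "t \<le> d \<Longrightarrow> avoid t \<le> 1"
  using avoid_antimono[of 0 t] avoid_0 by simp

lemma avoid_1: "avoid 1 = (\<Sum>i=0..d - 1. p i * ((real d - real i) / real d))"
  unfolding avoid_def atMost_atLeast0
proof (rule sum.cong[OF refl])
  fix i assume "i \<in> {0..d - 1}"
  then have "i < d" using d_ge by auto
  then have "real (d - 1 choose i) * weight i = p i * (real (d - 1 choose i) / real (d choose i))"
    by (simp add: weight_def)
  then show "real (d - 1 choose i) * weight i = p i * ((real d - real i) / real d)"
    using \<open>i < d\<close> by (simp only: choose_ratio1)
qed

lemma avoid_2: "avoid 2 = (\<Sum>i=0..d - 2. p i * ((real d - real i) * (real d - real i - 1) / (real d * (real d - 1))))"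
  unfolding avoid_def atMost_atLeast0
proof (rule sum.cong[OF refl])
  fix i assume "i \<in> {0..d - 2}"
  then have i: "i + 1 < d" using d_ge by auto
  then have "real (d - 2 choose i) * weight i = p i * (real (d - 2 choose i) / real (d choose i))"
    by (simp add: weight_def)
  then show "real (d - 2 choose i) * weight i
      = p i * ((real d - real i) * (real d - real i - 1) / (real d * (real d - 1)))"
    using i by (simp only: choose_ratio2)
qed

lemma weight_2: "weight 2 = 2 * p 2 / (real d * (real d - 1))"
proof -
  have "even (d * (d - 1))" by (cases "even d") auto
  then have "2 * (d choose 2) = d * (d - 1)" by (simp add: choose_two)
  then have "2 * real (d choose 2) = real d * (real d - 1)"
    using d_ge by (metis (no_types, lifting) of_nat_1 of_nat_diff of_nat_mult of_nat_numeral le_trans one_le_numeral)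
  then show ?thesis by (simp add: weight_def divide_simps)
qed

lemma weight_2_pos: "weight 2 > 0"
  using p2_pos d_ge by (simp add: weight_def)

text \<open>Since \<open>d >= 4\<close>, two neighbours remain outside the avoided pair, and the
  state consisting of them has positive weight because \<open>p 2 > 0\<close>.\<close>

lemma avoid_2_pos: "avoid 2 > 0"
proof -
  have "0 < real (d - 2 choose 2) * weight 2"
    using d_ge weight_2_pos by simp
  also have "\<dots> \<le> avoid 2"
    unfolding avoid_def using d_ge by (intro member_le_sum mult_nonneg_nonneg weight_nonneg) auto
  finally show ?thesis .
qed

lemma measure_state_single:
  assumes "S \<subseteq> nbrs (x :: 'n vertex)" shows "measure (state_measure p x) {S} = weight (card S)"
  using assms by (simp add: measure_state)

lemma weight_2_le_1: "weight 2 \<le> 1"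
proof -
  obtain S where S: "S \<subseteq> nbrs (0 :: 'n vertex)" "card S = 2"
    by (rule obtain_subset_with_card_n[of 2 "nbrs (0 :: 'n vertex)"]) (use d_ge in \<open>auto simp: card_nbrs_d\<close>)
  show ?thesis using measure_state_single[OF S(1)] S M.prob_le_1[of 0 "{S}"] by simp
qed

section \<open>Events that depend on finitely many vertices, and their independence\<close>

definition depends_on :: "'n vertex set \<Rightarrow> ('n config \<Rightarrow> bool) \<Rightarrow> bool" where
  "depends_on I Q \<longleftrightarrow> (\<forall>\<omega> \<omega>'. legal \<omega> \<longrightarrow> legal \<omega>' \<longrightarrow> (\<forall>x\<in>I. \<omega> x = \<omega>' x) \<longrightarrow> Q \<omega> \<longrightarrow> Q \<omega>')"

abbreviation event :: "('n config \<Rightarrow> bool) \<Rightarrow> 'n config set" where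
  "event Q \<equiv> {\<omega> \<in> space P. Q \<omega>}"

abbreviation Pr :: "('n config \<Rightarrow> bool) \<Rightarrow> real" where
  "Pr Q \<equiv> measure P (event Q)"

text \<open>The patterns on \<open>I\<close> that realise \<open>Q\<close>. For finite
  \<open>I\<close> they are finitely many, and if \<open>Q\<close> depends on \<open>I\<close> only,
  their cylinders partition the event.\<close>

definition states :: "'n vertex set \<Rightarrow> ('n config \<Rightarrow> bool) \<Rightarrow> 'n config set" where
  "states I Q = (\<lambda>\<omega>. restrict \<omega> I) ` {\<omega>. legal \<omega> \<and> Q \<omega>}"

lemma cylinder_event:
  assumes "finite I" "\<And>x. x \<in> I \<Longrightarrow> X x \<subseteq> Pow (nbrs x)"
  shows "event (\<lambda>\<omega>. \<forall>x\<in>I. \<omega> x \<in> X x) \<in> events"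
    and "Pr (\<lambda>\<omega>. \<forall>x\<in>I. \<omega> x \<in> X x) = (\<Prod>x\<in>I. measure (state_measure p x) (X x))"
proof -
  have eq: "event (\<lambda>\<omega>. \<forall>x\<in>I. \<omega> x \<in> X x) = prod_emb UNIV (state_measure p) I (PiE I X)"
    by (auto simp: prod_emb_def config_measure_def space_PiM Pi_iff)
  show "event (\<lambda>\<omega>. \<forall>x\<in>I. \<omega> x \<in> X x) \<in> events"
    unfolding eq using assms unfolding config_measure_def by (intro sets_PiM_I) (auto simp: sets_state)
  show "Pr (\<lambda>\<omega>. \<forall>x\<in>I. \<omega> x \<in> X x) = (\<Prod>x\<in>I. measure (state_measure p x) (X x))"
    unfolding eq using assms unfolding config_measure_def by (intro measure_PiM_emb) (auto simp: sets_state)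
qed

lemma states_finite: assumes "finite I" shows "finite (states I Q)"
proof (rule finite_subset)
  show "states I Q \<subseteq> PiE I (\<lambda>x. Pow (nbrs x))"
    unfolding states_def legal_def by auto blast
  show "finite (PiE I (\<lambda>x. Pow (nbrs x)))" using assms by (intro finite_PiE) auto
qed

lemma states_nbrs: "s \<in> states I Q \<Longrightarrow> x \<in> I \<Longrightarrow> s x \<subseteq> nbrs x"
  unfolding states_def legal_def by auto blast

lemma event_eq_states:
  assumes "depends_on I Q"
  shows "event Q = (\<Union>s\<in>states I Q. event (\<lambda>\<omega>. \<forall>x\<in>I. \<omega> x \<in> {s x}))"
  using assms unfolding states_def depends_on_def space_P by auto

lemma states_disjoint:
  "disjoint_family_on (\<lambda>s. event (\<lambda>\<omega>. \<forall>x\<in>I. \<omega> x \<in> {s x})) (states I Q)"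
proof (unfold disjoint_family_on_def, intro ballI impI)
  fix s t assume st: "s \<in> states I Q" "t \<in> states I Q" "s \<noteq> t"
  then obtain x where "s x \<noteq> t x" by (auto simp: fun_eq_iff)
  then have "x \<in> I" using st by (auto simp: states_def restrict_def split: if_splits)
  then show "event (\<lambda>\<omega>. \<forall>x\<in>I. \<omega> x \<in> {s x}) \<inter> event (\<lambda>\<omega>. \<forall>x\<in>I. \<omega> x \<in> {t x}) = {}"
    using \<open>s x \<noteq> t x\<close> by auto
qed

lemma event_measurable:
  assumes "finite I" "depends_on I Q" shows "event Q \<in> events"
  unfolding event_eq_states[OF assms(2)]
  using states_finite[OF assms(1)] states_nbrs
  by (intro sets.finite_UN cylinder_event assms) auto

lemma Pr_eq_sum:
  assumes "finite I" "depends_on I Q"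
  shows "Pr Q = (\<Sum>s\<in>states I Q. \<Prod>x\<in>I. measure (state_measure p x) {s x})"
proof -
  have "Pr Q = (\<Sum>s\<in>states I Q. Pr (\<lambda>\<omega>. \<forall>x\<in>I. \<omega> x \<in> {s x}))"
    unfolding event_eq_states[OF assms(2)]
    using states_finite[OF assms(1)] states_disjoint states_nbrs
    by (intro finite_measure_finite_Union image_subsetI cylinder_event assms) auto
  also have "\<dots> = (\<Sum>s\<in>states I Q. \<Prod>x\<in>I. measure (state_measure p x) {s x})"
    using states_nbrs by (intro sum.cong refl cylinder_event(2) assms) auto
  finally show ?thesis .
qed

lemma depends_on_mono: "depends_on I Q \<Longrightarrow> I \<subseteq> J \<Longrightarrow> depends_on J Q"
  unfolding depends_on_def by (meson subsetD)

lemma depends_on_conj: "depends_on I Q \<Longrightarrow> depends_on I R \<Longrightarrow> depends_on I (\<lambda>\<omega>. Q \<omega> \<and> R \<omega>)"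
  unfolding depends_on_def by blast

text \<open>The patterns of the conjunction on \<open>I \<union> J\<close> are exactly the pairs of
  patterns of \<open>Q\<close> and \<open>R\<close>, and the weight of a pair factorises.\<close>

lemma Pr_indep:
  assumes "finite I" "finite J" "I \<inter> J = {}" "depends_on I Q" "depends_on J R"
  shows "Pr (\<lambda>\<omega>. Q \<omega> \<and> R \<omega>) = Pr Q * Pr R"
proof -
  have dep: "depends_on (I \<union> J) (\<lambda>\<omega>. Q \<omega> \<and> R \<omega>)"
    using assms by (intro depends_on_conj) (auto elim: depends_on_mono)
  let ?w = "\<lambda>I s. \<Prod>x\<in>I. measure (state_measure p x) {s x}"
  \<comment> \<open>Glues two patterns; the value \<open>undefined\<close> elsewhere matches the
    convention of \<open>restrict\<close>.\<close>
  let ?m = "\<lambda>(s, t). (\<lambda>x. if x \<in> I then s x else if x \<in> J then t x else undefined)"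
  have inj: "inj_on ?m (states I Q \<times> states J R)"
  proof (rule inj_onI, clarify)
    fix s t s' t'
    assume st: "s \<in> states I Q" "t \<in> states J R" "s' \<in> states I Q" "t' \<in> states J R"
      and eq: "(\<lambda>x. if x \<in> I then s x else if x \<in> J then t x else undefined)
        = (\<lambda>x. if x \<in> I then s' x else if x \<in> J then t' x else undefined)"
    have "s x = s' x" for x
      using st fun_cong[OF eq, of x] by (cases "x \<in> I") (auto simp: states_def)
    moreover have "t x = t' x" for x
      using st fun_cong[OF eq, of x] assms(3) by (cases "x \<in> J") (auto simp: states_def split: if_splits)
    ultimately show "s = s' \<and> t = t'" by auto
  qed
  have img: "states (I \<union> J) (\<lambda>\<omega>. Q \<omega> \<and> R \<omega>) = ?m ` (states I Q \<times> states J R)"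
  proof
    show "states (I \<union> J) (\<lambda>\<omega>. Q \<omega> \<and> R \<omega>) \<subseteq> ?m ` (states I Q \<times> states J R)"
    proof
      fix u assume "u \<in> states (I \<union> J) (\<lambda>\<omega>. Q \<omega> \<and> R \<omega>)"
      then obtain \<omega> where o: "legal \<omega>" "Q \<omega>" "R \<omega>" "u = restrict \<omega> (I \<union> J)"
        by (auto simp: states_def)
      then have "u = ?m (restrict \<omega> I, restrict \<omega> J)" by (auto simp: restrict_def fun_eq_iff)
      moreover have "(restrict \<omega> I, restrict \<omega> J) \<in> states I Q \<times> states J R"
        using o by (auto simp: states_def)
      ultimately show "u \<in> ?m ` (states I Q \<times> states J R)" by blast
    qed
    show "?m ` (states I Q \<times> states J R) \<subseteq> states (I \<union> J) (\<lambda>\<omega>. Q \<omega> \<and> R \<omega>)"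
    proof clarify
      fix s t assume "s \<in> states I Q" "t \<in> states J R"
      then obtain \<omega> \<omega>' where o: "legal \<omega>" "Q \<omega>" "s = restrict \<omega> I" "legal \<omega>'" "R \<omega>'" "t = restrict \<omega>' J"
        by (auto simp: states_def)
      \<comment> \<open>Two separate realisations are merged; as \<open>I\<close> and
        \<open>J\<close> are disjoint, the merged configuration agrees with each of them on its own
        set.\<close>
      let ?u = "\<lambda>x. if x \<in> I then \<omega> x else \<omega>' x"
      have l: "legal ?u" using o by (auto simp: legal_def)
      have "\<forall>x\<in>I. \<omega> x = ?u x" "\<forall>x\<in>J. \<omega>' x = ?u x" using assms(3) by auto
      then have "Q ?u" "R ?u" using assms(4,5) o l unfolding depends_on_def by blast+
      moreover have "(\<lambda>x. if x \<in> I then s x else if x \<in> J then t x else undefined) = restrict ?u (I \<union> J)"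
        using o by (auto simp: restrict_def fun_eq_iff)
      ultimately show "(\<lambda>x. if x \<in> I then s x else if x \<in> J then t x else undefined) \<in> states (I \<union> J) (\<lambda>\<omega>. Q \<omega> \<and> R \<omega>)"
        using l unfolding states_def by blast
    qed
  qed
  have w: "?w (I \<union> J) (?m (s, t)) = ?w I s * ?w J t" for s t
  proof -
    have "?w (I \<union> J) (?m (s, t)) = ?w I (?m (s, t)) * ?w J (?m (s, t))"
      using assms by (intro prod.union_disjoint) auto
    moreover have "?w I (?m (s, t)) = ?w I s" by (intro prod.cong) auto
    moreover have "?w J (?m (s, t)) = ?w J t" using assms(3) by (intro prod.cong) auto
    ultimately show ?thesis by simp
  qed
  have "Pr (\<lambda>\<omega>. Q \<omega> \<and> R \<omega>) = (\<Sum>u\<in>?m ` (states I Q \<times> states J R). ?w (I \<union> J) u)"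
    using assms by (subst Pr_eq_sum[OF _ dep]) (simp_all add: img)
  also have "\<dots> = (\<Sum>st\<in>states I Q \<times> states J R. ?w (I \<union> J) (?m st))"
    by (subst sum.reindex[OF inj]) simp
  also have "\<dots> = (\<Sum>(s, t)\<in>states I Q \<times> states J R. ?w I s * ?w J t)"
    by (intro sum.cong refl) (use w in auto)
  also have "\<dots> = (\<Sum>s\<in>states I Q. ?w I s) * (\<Sum>t\<in>states J R. ?w J t)"
    by (simp add: sum_product sum.cartesian_product)
  also have "\<dots> = Pr Q * Pr R"
    using assms by (simp add: Pr_eq_sum[of I Q] Pr_eq_sum[of J R])
  finally show ?thesis .
qed

lemma Pr_indep_family:
  assumes "finite S" "\<And>s. s \<in> S \<Longrightarrow> finite (I s)" "\<And>s. s \<in> S \<Longrightarrow> depends_on (I s) (Q s)"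
    and "disjoint_family_on I S"
  shows "Pr (\<lambda>\<omega>. \<forall>s\<in>S. Q s \<omega>) = (\<Prod>s\<in>S. Pr (Q s))"
  using assms
proof (induction S)
  case empty
  then show ?case by (simp add: prob_space)
next
  case (insert a S)
  have "Pr (\<lambda>\<omega>. \<forall>s\<in>insert a S. Q s \<omega>) = Pr (\<lambda>\<omega>. Q a \<omega> \<and> (\<forall>s\<in>S. Q s \<omega>))" by simp
  also have "\<dots> = Pr (Q a) * Pr (\<lambda>\<omega>. \<forall>s\<in>S. Q s \<omega>)"
  proof (rule Pr_indep[of "I a" "\<Union>s\<in>S. I s"])
    show "finite (\<Union>s\<in>S. I s)" using insert by auto
    show "I a \<inter> (\<Union>s\<in>S. I s) = {}" using insert by (auto simp: disjoint_family_on_def)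
    have "depends_on (\<Union>s\<in>S. I s) (Q s)" if "s \<in> S" for s
      using that insert.prems(2) by (blast intro: depends_on_mono)
    then show "depends_on (\<Union>s\<in>S. I s) (\<lambda>\<omega>. \<forall>s\<in>S. Q s \<omega>)"
      unfolding depends_on_def by blast
  qed (use insert in auto)
  also have "\<dots> = (\<Prod>s\<in>insert a S. Pr (Q s))"
    using insert by (simp add: disjoint_family_on_def)
  finally show ?case .
qed

lemma Pr_mono: "event R \<in> events \<Longrightarrow> (\<And>\<omega>. legal \<omega> \<Longrightarrow> Q \<omega> \<Longrightarrow> R \<omega>) \<Longrightarrow> Pr Q \<le> Pr R"
  by (rule finite_measure_mono) (auto simp: space_P)

section \<open>Translation invariance of the product measure\<close>

lemma measurable_translate: "translate t \<in> measurable P P"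
proof -
  have "(\<lambda>\<omega>. \<lambda>x\<in>UNIV. translate t \<omega> x) \<in> measurable (PiM UNIV (state_measure p)) (PiM UNIV (state_measure p))"
  proof (rule measurable_restrict)
    fix x :: "'n vertex"
    have "(\<lambda>S. (+) t ` S) \<in> measurable (state_measure p (x - t)) (state_measure p x)"
      using nbrs_add[of t "x - t"] by (auto simp: state_measure_def space_point_measure sets_point_measure)
    then show "(\<lambda>\<omega>. translate t \<omega> x) \<in> measurable (PiM UNIV (state_measure p)) (state_measure p x)"
      unfolding translate_def by measurable
  qed
  then show ?thesis unfolding config_measure_def restrict_UNIV .
qed

text \<open>It suffices to compare finite cylinders, and there the factors match because the weight
  of a state depends on its cardinality alone.\<close>

lemma distr_translate: "distr P P (translate t) = P"
proof -
  have "distr P P (translate t) = PiM UNIV (state_measure p)"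
  proof (rule PiM_eq)
    show "sets (distr P P (translate t)) = sets (PiM UNIV (state_measure p))"
      by (simp add: config_measure_def)
    fix J :: "'n vertex set" and F
    assume J: "finite J" and F: "\<And>j. j \<in> J \<Longrightarrow> F j \<in> sets (state_measure p j)"
    let ?G = "\<lambda>x. {S \<in> Pow (nbrs x). (+) t ` S \<in> F (t + x)}"
    have e1: "prod_emb UNIV (state_measure p) J (PiE J F) = event (\<lambda>\<omega>. \<forall>j\<in>J. \<omega> j \<in> F j)"
      by (auto simp: prod_emb_def config_measure_def space_PiM Pi_iff)
    have "emeasure (distr P P (translate t)) (event (\<lambda>\<omega>. \<forall>j\<in>J. \<omega> j \<in> F j))
        = emeasure P (translate t -` event (\<lambda>\<omega>. \<forall>j\<in>J. \<omega> j \<in> F j) \<inter> space P)"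
      using J F by (intro emeasure_distr measurable_translate cylinder_event) (auto simp: sets_state)
    also have "translate t -` event (\<lambda>\<omega>. \<forall>j\<in>J. \<omega> j \<in> F j) \<inter> space P
        = event (\<lambda>\<omega>. \<forall>j\<in>(\<lambda>j. j - t) ` J. \<omega> j \<in> ?G j)"
      by (auto simp: space_P legal_translate) (auto simp: translate_def legal_def)
    also have "emeasure P \<dots> = ennreal (\<Prod>x\<in>(\<lambda>j. j - t) ` J. measure (state_measure p x) (?G x))"
      using J by (subst emeasure_eq_measure, subst cylinder_event(2)) auto
    also have "(\<Prod>x\<in>(\<lambda>j. j - t) ` J. measure (state_measure p x) (?G x))
        = (\<Prod>j\<in>J. measure (state_measure p (j - t)) (?G (j - t)))"
      by (subst prod.reindex) (auto simp: inj_on_def)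
    also have "\<dots> = (\<Prod>j\<in>J. measure (state_measure p j) (F j))"
    proof (rule prod.cong[OF refl])
      fix j assume j: "j \<in> J"
      have n: "nbrs j = (+) t ` nbrs (j - t)" using nbrs_add[of t "j - t"] by simp
      have Fj: "F j \<subseteq> Pow (nbrs j)" using F[OF j] by (simp add: sets_state)
      have "bij_betw ((`) ((+) t)) (?G (j - t)) (F j)"
      proof (rule bij_betwI[where g = "(`) ((+) (- t))"])
        show "(`) ((+) t) \<in> ?G (j - t) \<rightarrow> F j" by auto
        show "(`) ((+) (- t)) \<in> F j \<rightarrow> ?G (j - t)"
        proof
          fix S assume S: "S \<in> F j"
          then have "(+) (- t) ` S \<subseteq> (+) (- t) ` nbrs j" using Fj by blast
          also have "\<dots> = nbrs (j - t)" by (simp add: n image_image)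
          finally show "(+) (- t) ` S \<in> ?G (j - t)" using S by (simp add: image_image)
        qed
      qed (auto simp: image_image)
      then have "(\<Sum>S\<in>F j. weight (card S)) = (\<Sum>S\<in>?G (j - t). weight (card ((+) t ` S)))"
        by (rule sum.reindex_bij_betw[symmetric])
      also have "\<dots> = (\<Sum>S\<in>?G (j - t). weight (card S))"
        by (simp add: card_image)
      finally show "measure (state_measure p (j - t)) (?G (j - t)) = measure (state_measure p j) (F j)"
        using Fj by (subst (1 2) measure_state) auto
    qed
    also have "ennreal (\<Prod>j\<in>J. measure (state_measure p j) (F j)) = (\<Prod>j\<in>J. emeasure (state_measure p j) (F j))"
      by (simp add: M.emeasure_eq_measure prod_ennreal)
    finally show "emeasure (distr P P (translate t)) (prod_emb UNIV (state_measure p) J (PiE J F))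
        = (\<Prod>j\<in>J. emeasure (state_measure p j) (F j))"
      unfolding e1 .
  qed
  then show ?thesis by (simp add: config_measure_def)
qed

lemma Pr_translate:
  assumes "event Q \<in> events"
  shows "Pr (\<lambda>\<omega>. Q (translate t \<omega>)) = Pr Q"
proof -
  have "measure (distr P P (translate t)) (event Q) = measure P (translate t -` event Q \<inter> space P)"
    by (rule measure_distr[OF measurable_translate assms])
  also have "translate t -` event Q \<inter> space P = event (\<lambda>\<omega>. Q (translate t \<omega>))"
    by (auto simp: space_P legal_translate)
  finally show ?thesis by (simp add: distr_translate)
qed

end

section \<open>Joining two clusters\<close>

text \<open>All edges of the full cluster join vertices of \<open>A\<close>, so the states in
  \<open>A\<close> already reveal it. Connectivity of \<open>A\<close> therefore survives any change
  of states outside \<open>A\<close>.\<close>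

lemma cluster_in_inside:
  assumes "cluster_in UNIV \<omega> x = A" shows "cluster_in A \<omega> x = A"
proof
  show "cluster_in A \<omega> x \<subseteq> A" using assms cluster_in_mono[of A UNIV \<omega> x] by auto
  have "x \<in> A" using assms cluster_in_self by blast
  have "cluster_in UNIV \<omega> x \<subseteq> A \<inter> cluster_in A \<omega> x"
  proof (rule cluster_in_subset)
    fix a b assume a: "a \<in> A \<inter> cluster_in A \<omega> x" and ab: "(a, b) \<in> local_edges UNIV \<omega>"
    then have "b \<in> A" using assms cluster_in_step by blast
    moreover have "(a, b) \<in> local_edges A \<omega>" using ab a \<open>b \<in> A\<close> by (auto simp: local_edges_def)
    ultimately show "b \<in> A \<inter> cluster_in A \<omega> x" using a cluster_in_step by blast
  qed (use \<open>x \<in> A\<close> in auto)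
  then show "A \<subseteq> cluster_in A \<omega> x" using assms by auto
qed

text \<open>Phrased without the origin so that it applies to translated and joined sets; for sets
  containing the origin see \<open>is_cluster_origin\<close>.\<close>

definition is_cluster :: "'n::finite vertex set \<Rightarrow> 'n config \<Rightarrow> bool" where
  "is_cluster A \<omega> \<longleftrightarrow> (\<forall>x\<in>A. cluster_in UNIV \<omega> x = A)"

lemma is_clusterD:
  assumes "is_cluster A \<omega>"
  shows "a \<in> A \<Longrightarrow> \<omega> a \<subseteq> A" and "z \<notin> A \<Longrightarrow> \<omega> z \<inter> A = {}" and "a \<in> A \<Longrightarrow> cluster_in A \<omega> a = A"
proof -
  show "\<omega> a \<subseteq> A" if "a \<in> A"
  proof
    fix b assume "b \<in> \<omega> a"
    then have "(a, b) \<in> local_edges UNIV \<omega>" by (simp add: local_edges_def)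
    then have "b \<in> cluster_in UNIV \<omega> a" using cluster_in_step cluster_in_self by blast
    then show "b \<in> A" using assms that by (simp add: is_cluster_def)
  qed
  show "\<omega> z \<inter> A = {}" if "z \<notin> A"
  proof (rule ccontr)
    assume "\<omega> z \<inter> A \<noteq> {}"
    then obtain a where a: "a \<in> A" "a \<in> \<omega> z" by auto
    then have "(a, z) \<in> local_edges UNIV \<omega>" by (simp add: local_edges_def)
    then have "z \<in> cluster_in UNIV \<omega> a" using cluster_in_step cluster_in_self by blast
    then show False using assms that a by (simp add: is_cluster_def)
  qed
  show "a \<in> A \<Longrightarrow> cluster_in A \<omega> a = A"
    using assms by (simp add: is_cluster_def cluster_in_inside)
qed

text \<open>Separates the two closure conditions, which can be checked vertex by vertex, from
  connectivity.\<close>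

lemma is_clusterI:
  assumes "x \<in> A" "\<And>a. a \<in> A \<Longrightarrow> \<omega> a \<subseteq> A" "\<And>z. z \<notin> A \<Longrightarrow> \<omega> z \<inter> A = {}"
    and "A \<subseteq> cluster_in UNIV \<omega> x"
  shows "is_cluster A \<omega>"
proof -
  have "cluster_in UNIV \<omega> x \<subseteq> A"
    by (rule cluster_in_subset) (use assms(1-3) in \<open>auto simp: local_edges_def\<close>)
  then show ?thesis using assms(4) cluster_in_eq unfolding is_cluster_def by blast
qed

lemma is_cluster_origin: "0 \<in> A \<Longrightarrow> is_cluster A \<omega> \<longleftrightarrow> origin_cluster \<omega> = A"
  unfolding is_cluster_def origin_cluster_eq using cluster_in_eq by blast

lemma nbhd_coord: "z \<in> nbhd A \<Longrightarrow> \<exists>a\<in>A. \<bar>z $ i - a $ i\<bar> \<le> 1"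
  unfolding nbhd_def using nbrs_coord by force

text \<open>Only the \<open>k\<close> interior vertices of the segment: its endpoints
  \<open>x\<close> and \<open>x + axis i0 (int (Suc k))\<close> will belong to the two clusters
  being joined.\<close>

definition chain :: "'n::finite \<Rightarrow> 'n vertex \<Rightarrow> nat \<Rightarrow> 'n vertex set" where
  "chain i0 x k = (\<lambda>i. x + axis i0 (int i)) ` {1..k}"

definition sides :: "'n::finite \<Rightarrow> 'n vertex \<Rightarrow> nat \<Rightarrow> 'n vertex set" where
  "sides i0 x k = (\<Union>y\<in>chain i0 x k. (\<lambda>(j, s). y + axis j s) ` ((UNIV - {i0}) \<times> {1, -1}))"

lemma card_chain: "card (chain i0 x k) = k"
  unfolding chain_def by (subst card_image) (auto simp: inj_on_def axis_eq_axis)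

lemma finite_chain [simp]: "finite (chain i0 x k)" "finite (sides i0 x k)"
  by (auto simp: chain_def sides_def)

lemma card_sides: "card (sides i0 (x :: 'n::finite vertex) k) \<le> k * (lattice_degree TYPE('n) - 2)"
proof -
  have "card (sides i0 x k) \<le> (\<Sum>y\<in>chain i0 x k. card ((\<lambda>(j, s). y + axis j (s::int)) ` ((UNIV - {i0}) \<times> {1, -1})))"
    unfolding sides_def by (rule card_UN_le) simp
  also have "\<dots> \<le> (\<Sum>y\<in>chain i0 x k. lattice_degree TYPE('n) - 2)"
  proof (rule sum_mono)
    fix y :: "'n vertex"
    have "card ((\<lambda>(j, s). y + axis j (s::int)) ` ((UNIV - {i0}) \<times> {1, -1})) \<le> card ((UNIV - {i0}) \<times> {1, -1 :: int})"
      by (rule card_image_le) simp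
    also have "\<dots> = lattice_degree TYPE('n) - 2"
      by (simp add: card_cartesian_product lattice_degree_def card_Diff_singleton)
    finally show "card ((\<lambda>(j, s). y + axis j (s::int)) ` ((UNIV - {i0}) \<times> {1, -1})) \<le> lattice_degree TYPE('n) - 2" .
  qed
  finally show ?thesis by (simp add: card_chain)
qed

context degenerate_environment
begin

definition cluster_prob :: "'n vertex set \<Rightarrow> real" where
  "cluster_prob A = Pr (is_cluster A)"

lemma is_cluster_depends: "depends_on (nbhd A) (is_cluster A)"
  unfolding depends_on_def is_cluster_def using cluster_in_determined[where F = UNIV and A = A] by blast

lemma is_cluster_measurable: "finite A \<Longrightarrow> event (is_cluster A) \<in> events"
  using event_measurable[OF finite_nbhd is_cluster_depends] .

lemma is_cluster_translate: "is_cluster ((+) t ` A) (translate t \<omega>) \<longleftrightarrow> is_cluster A \<omega>"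
  using cluster_in_translate[of t UNIV \<omega>] by (simp add: is_cluster_def inj_image_eq_iff)

lemma cluster_prob_translate:
  assumes "finite A" shows "cluster_prob ((+) t ` A) = cluster_prob A"
  using Pr_translate[OF is_cluster_measurable, of "(+) t ` A" t] assms
  by (simp add: is_cluster_translate cluster_prob_def)

text \<open>The price of a chain: one prescribed two-element state at each of its \<open>k\<close>
  vertices, and at most \<open>k * (d - 2)\<close> vertices beside it that must avoid at most two
  neighbours each.\<close>

definition link :: "nat \<Rightarrow> real" where
  "link k = weight 2 ^ k * avoid 2 ^ (k * (d - 2))"

lemma link_pos: "link k > 0"
  by (simp add: link_def weight_2_pos avoid_2_pos)

text \<open>The probability is a product over vertices. Coinciding side vertices and smaller avoided
  sets only increase it, because \<open>avoid 2 <= 1\<close> and \<open>avoid\<close> is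
  decreasing.\<close>

lemma link_event:
  fixes U :: "'n vertex set" and x :: "'n vertex"
  assumes "\<And>z. z \<in> sides i0 x k \<Longrightarrow> card (U \<inter> nbrs z) \<le> 2"
    and disj: "chain i0 x k \<inter> sides i0 x k = {}"
  defines "X \<equiv> \<lambda>z. if z \<in> chain i0 x k then {{z - axis i0 1, z + axis i0 1}} else {T \<in> Pow (nbrs z). T \<inter> U = {}}"
  shows "Pr (\<lambda>\<omega>. \<forall>z\<in>chain i0 x k \<union> sides i0 x k. \<omega> z \<in> X z) \<ge> link k"
    and "event (\<lambda>\<omega>. \<forall>z\<in>chain i0 x k \<union> sides i0 x k. \<omega> z \<in> X z) \<in> events"
proof -
  let ?Y = "chain i0 x k" and ?S = "sides i0 x k"
  have two: "{z - axis i0 1, z + axis i0 1} \<subseteq> nbrs z" "card {z - axis i0 1, z + axis i0 (1::int)} = 2" for z :: "'n vertex"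
  proof -
    show "{z - axis i0 1, z + axis i0 1} \<subseteq> nbrs z"
      using nbrsI[of 1 z i0] nbrsI[of "-1" z i0] by (simp add: axis_uminus)
    have "(z - axis i0 1) $ i0 \<noteq> (z + axis i0 (1::int)) $ i0" by (simp add: axis_def)
    then have "z - axis i0 1 \<noteq> z + axis i0 (1::int)" by metis
    then show "card {z - axis i0 1, z + axis i0 (1::int)} = 2" by simp
  qed
  have X: "X z \<subseteq> Pow (nbrs z)" for z using two(1) by (auto simp: X_def)
  have "link k \<le> weight 2 ^ card ?Y * avoid 2 ^ card ?S"
    unfolding link_def card_chain using card_sides[of i0 x k] avoid_2_pos avoid_le_1[of 2] d_ge weight_2_pos
    by (intro mult_left_mono power_decreasing) (auto simp: d_def)
  also have "\<dots> \<le> (\<Prod>z\<in>?Y. measure (state_measure p z) (X z)) * (\<Prod>z\<in>?S. measure (state_measure p z) (X z))"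
  proof (intro mult_mono)
    show "weight 2 ^ card ?Y \<le> (\<Prod>z\<in>?Y. measure (state_measure p z) (X z))"
      using two by (simp add: X_def measure_state_single)
    have "(\<Prod>z\<in>?S. avoid 2) \<le> (\<Prod>z\<in>?S. measure (state_measure p z) (X z))"
    proof (rule prod_mono)
      fix z assume z: "z \<in> ?S"
      have "X z = {T \<in> Pow (nbrs z). T \<inter> (U \<inter> nbrs z) = {}}"
        using z disj by (auto simp: X_def)
      then have "measure (state_measure p z) (X z) = avoid (card (U \<inter> nbrs z))"
        using measure_state_avoid[of "U \<inter> nbrs z" z] by simp
      then show "0 \<le> avoid 2 \<and> avoid 2 \<le> measure (state_measure p z) (X z)"
        using assms(1)[OF z] avoid_antimono[of _ 2] avoid_2_pos d_ge by simp
    qed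
    then show "avoid 2 ^ card ?S \<le> (\<Prod>z\<in>?S. measure (state_measure p z) (X z))" by simp
  qed (use avoid_2_pos in \<open>auto intro: prod_nonneg\<close>)
  also have "\<dots> = (\<Prod>z\<in>?Y \<union> ?S. measure (state_measure p z) (X z))"
    using disj by (intro prod.union_disjoint[symmetric]) auto
  also have "\<dots> = Pr (\<lambda>\<omega>. \<forall>z\<in>?Y \<union> ?S. \<omega> z \<in> X z)"
    using X by (intro cylinder_event(2)[symmetric]) auto
  finally show "link k \<le> Pr (\<lambda>\<omega>. \<forall>z\<in>?Y \<union> ?S. \<omega> z \<in> X z)" .
  show "event (\<lambda>\<omega>. \<forall>z\<in>?Y \<union> ?S. \<omega> z \<in> X z) \<in> events"
    using X by (intro cylinder_event(1)) auto
qed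

text \<open>Two clusters on opposite sides of a slab of width \<open>k \<ge> 2\<close> have disjoint neighbourhoods, hence are
  independent; the states along the chain and next to it are resampled to connect them. The states next to the
  chain have to avoid at most two vertices, since \<open>k \<ge> 2\<close> keeps them from touching both clusters.\<close>

lemma cluster_prob_join:
  fixes A B :: "'n vertex set" and x :: "'n vertex"
  assumes fin: "finite A" "finite B" and k: "k \<ge> 2"
    and xA: "x \<in> A" and A: "\<And>a. a \<in> A \<Longrightarrow> a $ i0 \<le> x $ i0"
    and bB: "x + axis i0 (int (Suc k)) \<in> B" and B: "\<And>b. b \<in> B \<Longrightarrow> x $ i0 + int (Suc k) \<le> b $ i0"
  shows "cluster_prob (A \<union> chain i0 x k \<union> B) \<ge> link k * cluster_prob A * cluster_prob B"
proof -
  let ?Y = "chain i0 x k" and ?S = "sides i0 x k" and ?e = "axis i0 (1::int)"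
  let ?U = "A \<union> ?Y \<union> B" and ?M = "?Y \<union> ?S"
  \<comment> \<open>\<open>node 0\<close> and \<open>node (Suc k)\<close> are the endpoints in
    \<open>A\<close> and \<open>B\<close>; the chain is \<open>node 1, ..., node k\<close>.\<close>
  define node where "node i = x + axis i0 (int i)" for i
  have node_coord: "node i $ i0 = x $ i0 + int i" "j \<noteq> i0 \<Longrightarrow> node i $ j = x $ j" for i j
    by (auto simp: node_def axis_def)
  have node_Suc: "node i + ?e = node (Suc i)" for i
    by (auto simp: node_def vec_eq_iff axis_def)
  have Y: "?Y = node ` {1..k}" by (simp add: chain_def node_def)
  have Se: "\<exists>i j s. 1 \<le> i \<and> i \<le> k \<and> j \<noteq> i0 \<and> (s = 1 \<or> s = -1) \<and> z = node i + axis j s" if "z \<in> ?S" for z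
    using that unfolding sides_def Y by fastforce
  have SI: "node i + axis j s \<in> ?S" if "1 \<le> i" "i \<le> k" "j \<noteq> i0" "s = 1 \<or> s = -1" for i j s
    using that unfolding sides_def Y by force
  \<comment> \<open>The resampled vertices have heights strictly between those of \<open>A\<close>
    and \<open>B\<close>, hence lie in neither.\<close>
  have Mc: "x $ i0 + 1 \<le> z $ i0 \<and> z $ i0 \<le> x $ i0 + int k" if "z \<in> ?M" for z
  proof (cases "z \<in> ?Y")
    case True then show ?thesis by (auto simp: Y node_coord)
  next
    case False
    then have "z \<in> ?S" using that by blast
    then obtain i j s where "1 \<le> i" "i \<le> k" "j \<noteq> i0" "z = node i + axis j s"
      using Se by blast
    then show ?thesis by (simp add: node_coord) (simp add: axis_def)
  qed
  have MA: "?M \<inter> A = {}" "?M \<inter> B = {}" using Mc A B by fastforce+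
  have disj: "?Y \<inter> ?S = {}"
  proof (rule ccontr)
    assume "?Y \<inter> ?S \<noteq> {}"
    then obtain z where z: "z \<in> ?Y" "z \<in> ?S" by auto
    obtain i j s where z1: "j \<noteq> i0" "s = 1 \<or> s = -1" "z = node i + axis j s" using Se z by blast
    then have "z $ j = x $ j + s" by (simp add: node_coord)
    moreover have "z $ j = x $ j" using z(1) z1(1) by (auto simp: Y node_coord)
    ultimately show False using z1(2) by auto
  qed
  have side2: "card (?U \<inter> nbrs z) \<le> 2" if z: "z \<in> ?S" for z
  proof -
    obtain i j s where ij: "1 \<le> i" "i \<le> k" "j \<noteq> i0" "s = 1 \<or> s = -1" "z = node i + axis j s"
      using Se z by blast
    have zc: "z $ i0 = x $ i0 + int i" "z $ j = x $ j + s"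
      using ij(3) by (auto simp: ij(5) node_coord axis_def)
    \<comment> \<open>Besides \<open>node i\<close>, a side vertex can touch \<open>A\<close> only
      at level 1 and \<open>B\<close> only at level \<open>k\<close>, and these levels differ. At
      intermediate levels the second element merely fills the list.\<close>
    have "?U \<inter> nbrs z \<subseteq> {node i, if i = 1 then z - ?e else z + ?e}"
    proof
      fix u assume u: "u \<in> ?U \<inter> nbrs z"
      then obtain l t where t: "t = 1 \<or> t = -1" "u = z + axis l t" using nbrs_cases by blast
      show "u \<in> {node i, if i = 1 then z - ?e else z + ?e}"
      proof (cases "l = i0")
        case False
        then have uc: "u $ i0 = x $ i0 + int i" using t zc by (simp add: axis_def)
        have "u \<notin> A" using A[of u] uc ij by auto
        moreover have "u \<notin> B" using B[of u] uc ij by auto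
        ultimately have "u \<in> ?Y" using u by auto
        then have "u = node i" using uc by (auto simp: Y node_coord)
        then show ?thesis by simp
      next
        case True
        have "u $ j = x $ j + s" using True t zc ij(3) by (simp add: axis_def)
        then have "u \<notin> ?Y" using ij(3,4) by (auto simp: Y node_coord)
        then have AB: "u \<in> A \<or> u \<in> B" using u by auto
        have uc: "u $ i0 = x $ i0 + int i + t" using True t zc by simp
        have "(t = -1 \<and> i = 1) \<or> (t = 1 \<and> i = k)"
          using AB A[of u] B[of u] uc t(1) ij(1,2) by auto
        then show ?thesis using t(2) True k by (auto simp: axis_uminus)
      qed
    qed
    then have "card (?U \<inter> nbrs z) \<le> card {node i, if i = 1 then z - ?e else z + ?e}"
      by (intro card_mono) auto
    also have "\<dots> \<le> 2" by (simp add: card_insert_le_m1)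
    finally show ?thesis .
  qed
  define X where "X = (\<lambda>z. if z \<in> ?Y then {{z - ?e, z + ?e}} else {T \<in> Pow (nbrs z). T \<inter> ?U = {}})"
  define E where "E = (\<lambda>\<omega>. \<forall>z\<in>?M. \<omega> z \<in> X z)"
  \<comment> \<open>\<open>EA C\<close> asks that the states off \<open>?M\<close> can be completed
    to a configuration with cluster \<open>C\<close>. It is implied by \<open>is_cluster C\<close>
    but ignores the resampled states, and so is independent of \<open>E\<close>.\<close>
  define EA where "EA = (\<lambda>C \<omega>. \<exists>\<omega>'. legal \<omega>' \<and> (\<forall>z\<in>nbhd C - ?M. \<omega> z = \<omega>' z) \<and> is_cluster C \<omega>')"
  have PE: "Pr E \<ge> link k" "event E \<in> events"
    unfolding E_def X_def using link_event[of i0 x k ?U] side2 disj by auto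
  have depE: "depends_on ?M E" unfolding E_def depends_on_def by auto
  have depA: "depends_on (nbhd C - ?M) (EA C)" for C
    unfolding EA_def depends_on_def by metis
  have PA: "cluster_prob C \<le> Pr (EA C)" if "finite C" for C
    unfolding cluster_prob_def
  proof (rule Pr_mono)
    show "event (EA C) \<in> events" using depA that by (intro event_measurable[of "nbhd C - ?M"]) auto
  qed (auto simp: EA_def)
  \<comment> \<open>The heights of \<open>A\<close> and \<open>B\<close> differ by at least
    \<open>k + 1 >= 3\<close>, while a common neighbour would bring them within 2.\<close>
  have nAB: "nbhd A \<inter> nbhd B = {}"
  proof (rule ccontr)
    assume "nbhd A \<inter> nbhd B \<noteq> {}"
    then obtain z a b where "a \<in> A" "b \<in> B" "\<bar>z $ i0 - a $ i0\<bar> \<le> 1" "\<bar>z $ i0 - b $ i0\<bar> \<le> 1"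
      using nbhd_coord[of _ A i0] nbhd_coord[of _ B i0] by blast
    then show False using A[of a] B[of b] k by auto
  qed
  have "link k * cluster_prob A * cluster_prob B \<le> Pr E * Pr (EA A) * Pr (EA B)"
    using PE(1) PA fin link_pos[of k] by (intro mult_mono) (auto simp: cluster_prob_def)
  also have "\<dots> = Pr (\<lambda>\<omega>. (E \<omega> \<and> EA A \<omega>) \<and> EA B \<omega>)"
  proof -
    have "Pr (\<lambda>\<omega>. E \<omega> \<and> EA A \<omega>) = Pr E * Pr (EA A)"
      by (rule Pr_indep[of ?M "nbhd A - ?M"]) (use depE depA fin in auto)
    moreover have "Pr (\<lambda>\<omega>. (E \<omega> \<and> EA A \<omega>) \<and> EA B \<omega>) = Pr (\<lambda>\<omega>. E \<omega> \<and> EA A \<omega>) * Pr (EA B)"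
    proof (rule Pr_indep[of "?M \<union> nbhd A" "nbhd B - ?M"])
      show "depends_on (?M \<union> nbhd A) (\<lambda>\<omega>. E \<omega> \<and> EA A \<omega>)"
        using depE depA[of A] by (auto intro!: depends_on_conj elim: depends_on_mono)
    qed (use depA fin nAB in auto)
    ultimately show ?thesis by simp
  qed
  also have "\<dots> \<le> Pr (is_cluster ?U)"
  proof (rule Pr_mono)
    show "event (is_cluster ?U) \<in> events" using fin by (intro is_cluster_measurable) auto
    fix \<omega> assume leg: "legal \<omega>" and "(E \<omega> \<and> EA A \<omega>) \<and> EA B \<omega>"
    then obtain \<omega>1 \<omega>2 where E: "E \<omega>" and
      w1: "legal \<omega>1" "\<And>z. z \<in> nbhd A - ?M \<Longrightarrow> \<omega> z = \<omega>1 z" "is_cluster A \<omega>1" and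
      w2: "legal \<omega>2" "\<And>z. z \<in> nbhd B - ?M \<Longrightarrow> \<omega> z = \<omega>2 z" "is_cluster B \<omega>2"
      unfolding EA_def by blast
    have onA: "\<omega> a = \<omega>1 a" if "a \<in> A" for a using w1(2) that MA by (auto simp: nbhd_def)
    have onB: "\<omega> a = \<omega>2 a" if "a \<in> B" for a using w2(2) that MA by (auto simp: nbhd_def)
    have chainst: "\<omega> (node i) = {node (i - 1), node (Suc i)}" if "1 \<le> i" "i \<le> k" for i
    proof -
      have "node i \<in> ?Y" using that by (auto simp: Y)
      then have "\<omega> (node i) \<in> X (node i)" using E unfolding E_def by blast
      then have "\<omega> (node i) = {node i - ?e, node i + ?e}" using \<open>node i \<in> ?Y\<close> by (simp add: X_def)
      moreover have "node i - ?e = node (i - 1)" using node_Suc[of "i - 1"] that by (simp add: algebra_simps)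
      ultimately show ?thesis by (simp add: node_Suc)
    qed
    have nodeU: "node i \<in> ?U" if i: "i \<le> Suc k" for i
    proof -
      consider "i = 0" | "1 \<le> i" "i \<le> k" | "i = Suc k" using i by linarith
      then show ?thesis
      proof cases
        case 1
        then have "node i = x" by (simp add: node_def axis_def vec_eq_iff)
        then show ?thesis using xA by simp
      next
        case 2 then show ?thesis by (auto simp: Y)
      next
        case 3 then show ?thesis using bB by (simp add: node_def)
      qed
    qed
    \<comment> \<open>Since \<open>A\<close> contains no resampled vertex, the states there are
      those of the witness \<open>\<omega>1\<close>, and they alone connect
      \<open>A\<close>.\<close>
    have CA: "cluster_in A \<omega> a = A" if "a \<in> A" for a
      using cluster_in_cong[of A \<omega> \<omega>1 a] onA is_clusterD(3)[OF w1(3) that] by simp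
    have CB: "cluster_in B \<omega> b = B" if "b \<in> B" for b
      using cluster_in_cong[of B \<omega> \<omega>2 b] onB is_clusterD(3)[OF w2(3) that] by simp
    let ?C = "cluster_in UNIV \<omega> x"
    have nodeC: "node i \<in> ?C" if "i \<le> Suc k" for i
      using that
    proof (induction i)
      case 0
      have "node 0 = x" by (simp add: node_def axis_def vec_eq_iff)
      then show ?case by simp
    next
      case (Suc i)
      have "(node i, node (Suc i)) \<in> local_edges UNIV \<omega>"
      proof (cases "i = k")
        case True
        then show ?thesis using chainst[of k] k by (simp add: local_edges_def)
      next
        case False
        then show ?thesis using chainst[of "Suc i"] Suc.prems by (simp add: local_edges_def)
      qed
      then show ?case using Suc cluster_in_step by (meson Suc_leD)
    qed
    show "is_cluster ?U \<omega>"
    proof (rule is_clusterI[of x])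
      show "x \<in> ?U" using xA by simp
      show "\<omega> a \<subseteq> ?U" if a: "a \<in> ?U" for a
      proof -
        consider "a \<in> A" | i where "1 \<le> i" "i \<le> k" "a = node i" | "a \<in> B"
          using a by (auto simp: Y)
        then show ?thesis
        proof cases
          case 1 then show ?thesis using onA is_clusterD(1)[OF w1(3)] by auto
        next
          case 2
          moreover have "i - 1 \<le> Suc k" "Suc i \<le> Suc k" using 2 by linarith+
          ultimately show ?thesis using chainst nodeU by (simp only: chainst) blast
        next
          case 3 then show ?thesis using onB is_clusterD(1)[OF w2(3)] by auto
        qed
      qed
      show "\<omega> z \<inter> ?U = {}" if z: "z \<notin> ?U" for z
      proof (cases "z \<in> ?S")
        case True
        then have "\<omega> z \<in> X z" "z \<notin> ?Y" using E disj unfolding E_def by blast+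
        then show ?thesis by (simp add: X_def)
      next
        \<comment> \<open>Away from \<open>?M\<close>, edges into \<open>A\<close> or
          \<open>B\<close> are excluded by the witnesses. A neighbour of the chain that is not a
          side vertex lies on the axis, hence in \<open>?U\<close>.\<close>
        case False
        then have zM: "z \<notin> ?M" using z by auto
        show ?thesis
        proof (rule ccontr)
          assume "\<omega> z \<inter> ?U \<noteq> {}"
          then obtain u where u: "u \<in> \<omega> z" "u \<in> ?U" by auto
          then have zu: "z \<in> nbrs u" using leg nbrs_sym unfolding legal_def by blast
          consider "u \<in> A" | i where "1 \<le> i" "i \<le> k" "u = node i" | "u \<in> B"
            using u(2) by (auto simp: Y)
          then show False
          proof cases
            case 1
            then have "z \<in> nbhd A - ?M" using zu zM by (auto simp: nbhd_def)
            then show False using w1(2) is_clusterD(2)[OF w1(3), of z] u 1 z by auto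
          next
            case 3
            then have "z \<in> nbhd B - ?M" using zu zM by (auto simp: nbhd_def)
            then show False using w2(2) is_clusterD(2)[OF w2(3), of z] u 3 z by auto
          next
            case 2
            obtain l t where t: "t = 1 \<or> t = -1" "z = u + axis l t" using zu nbrs_cases by blast
            have "l = i0" using SI[of i l t] False t 2 by auto
            moreover have "node i + ?e = node (Suc i)" "node i - ?e = node (i - 1)"
              using node_Suc[of i] node_Suc[of "i - 1"] 2 by (auto simp: algebra_simps)
            ultimately have "z = node (Suc i) \<or> z = node (i - 1)"
              using t 2 by (auto simp: axis_uminus)
            moreover have "i - 1 \<le> Suc k" "Suc i \<le> Suc k" using 2 by linarith+
            ultimately show False using z nodeU by blast
          qed
        qed
      qed
      have "A \<subseteq> ?C" using CA[OF xA] cluster_in_mono[of A UNIV \<omega> x] by auto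
      moreover have "?Y \<subseteq> ?C" using nodeC by (auto simp: Y)
      moreover have "B \<subseteq> ?C"
      proof -
        have "node (Suc k) \<in> B" using bB by (simp add: node_def)
        then have "B \<subseteq> cluster_in UNIV \<omega> (node (Suc k))"
          using CB cluster_in_mono[of B UNIV \<omega> "node (Suc k)"] by auto
        then show ?thesis using nodeC[of "Suc k"] cluster_in_eq by blast
      qed
      ultimately show "?U \<subseteq> ?C" by auto
    qed
  qed
  finally show ?thesis by (simp add: cluster_prob_def)
qed

end

section \<open>Counting joined clusters\<close>

text \<open>These recover the two pieces of a joined cluster from its shape and their sizes. All admissible heights \<open>h\<close>
  give the same set; if there is none, \<open>SOME\<close> is arbitrary.\<close>

definition slab_below :: "'n::finite \<Rightarrow> nat \<Rightarrow> 'n vertex set \<Rightarrow> 'n vertex set" where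
  "slab_below i0 q W = {w \<in> W. w $ i0 \<le> (SOME h. card {w \<in> W. w $ i0 \<le> h} = q)}"

definition slab_above :: "'n::finite \<Rightarrow> nat \<Rightarrow> 'n vertex set \<Rightarrow> 'n vertex set" where
  "slab_above i0 q W = {w \<in> W. w $ i0 \<ge> (SOME h. card {w \<in> W. w $ i0 \<ge> h} = q)}"

text \<open>Sublevel sets of the height are nested, and nested finite sets of equal size
  coincide.\<close>

lemma slab_below_eq:
  assumes "finite W" "card {w \<in> W. w $ i0 \<le> h} = q"
  shows "slab_below i0 q W = {w \<in> W. w $ i0 \<le> h}"
proof -
  let ?h = "SOME h. card {w \<in> W. w $ i0 \<le> h} = q"
  have c: "card {w \<in> W. w $ i0 \<le> ?h} = q" by (rule someI[of _ h]) fact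
  have "{w \<in> W. w $ i0 \<le> ?h} = {w \<in> W. w $ i0 \<le> h}"
  proof (cases "?h \<le> h")
    case True
    then show ?thesis using c assms by (intro card_subset_eq) auto
  next
    case False
    then show ?thesis using c assms by (intro card_subset_eq[symmetric]) auto
  qed
  then show ?thesis by (simp add: slab_below_def)
qed

lemma slab_above_eq:
  assumes "finite W" "card {w \<in> W. w $ i0 \<ge> h} = q"
  shows "slab_above i0 q W = {w \<in> W. w $ i0 \<ge> h}"
proof -
  let ?h = "SOME h. card {w \<in> W. w $ i0 \<ge> h} = q"
  have c: "card {w \<in> W. w $ i0 \<ge> ?h} = q" by (rule someI[of _ h]) fact
  have "{w \<in> W. w $ i0 \<ge> ?h} = {w \<in> W. w $ i0 \<ge> h}"
  proof (cases "h \<le> ?h")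
    case True
    then show ?thesis using c assms by (intro card_subset_eq) auto
  next
    case False
    then show ?thesis using c assms by (intro card_subset_eq[symmetric]) auto
  qed
  then show ?thesis by (simp add: slab_above_def)
qed

context degenerate_environment
begin

definition size_prob :: "nat \<Rightarrow> real" where
  "size_prob n = Pr (\<lambda>\<omega>. cluster_size \<omega> = enat n)"

text \<open>Positive probability forces such a set to be realised as a connected cluster, which
  confines it to a bounded cube and makes the family finite.\<close>

definition clusters :: "nat \<Rightarrow> 'n vertex set set" where
  "clusters n = {A. finite A \<and> 0 \<in> A \<and> card A = n \<and> cluster_prob A > 0}"

lemma cluster_prob_nonneg: "cluster_prob A \<ge> 0"
  by (simp add: cluster_prob_def)

lemma cluster_size_eq: "cluster_size \<omega> = enat n \<longleftrightarrow> finite (origin_cluster \<omega>) \<and> card (origin_cluster \<omega>) = n"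
  by (simp add: cluster_size_def)

lemma origin_cluster_subset_cube:
  assumes "legal \<omega>" "finite (origin_cluster \<omega>)"
  shows "origin_cluster \<omega> \<subseteq> cube 0 (card (origin_cluster \<omega>))"
  using card_cluster_ge[of \<omega> UNIV 0 "card (origin_cluster \<omega>)"] assms unfolding origin_cluster_eq by force

lemma clusters_subset_cube:
  assumes "A \<in> clusters n" shows "A \<subseteq> cube 0 n"
proof -
  have "event (is_cluster A) \<noteq> {}"
    using assms by (auto simp: clusters_def cluster_prob_def simp del: Collect_empty_eq)
  then obtain \<omega> where "legal \<omega>" "is_cluster A \<omega>" by (auto simp: space_P)
  then show ?thesis
    using origin_cluster_subset_cube[of \<omega>] assms by (auto simp: clusters_def is_cluster_origin)
qed

lemma finite_clusters: "finite (clusters n)"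
  using clusters_subset_cube by (intro finite_subset[of "clusters n" "Pow (cube 0 n)"]) auto

text \<open>A cluster of \<open>n\<close> vertices cannot leave \<open>cube 0 n\<close>, so the
  event is a finite union over shapes; measurability and \<open>size_prob_eq\<close> follow from
  this.\<close>

lemma cluster_size_event:
  "event (\<lambda>\<omega>. cluster_size \<omega> = enat n) = (\<Union>A\<in>{A. A \<subseteq> cube 0 n \<and> 0 \<in> A \<and> card A = n}. event (is_cluster A))"
proof -
  have "cluster_size \<omega> = enat n \<longleftrightarrow> (\<exists>A. A \<subseteq> cube 0 n \<and> 0 \<in> A \<and> card A = n \<and> is_cluster A \<omega>)" if "legal \<omega>" for \<omega>
  proof
    assume "cluster_size \<omega> = enat n"
    then have "finite (origin_cluster \<omega>)" "card (origin_cluster \<omega>) = n" by (auto simp: cluster_size_eq)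
    moreover have "0 \<in> origin_cluster \<omega>" by (simp add: origin_cluster_eq)
    ultimately show "\<exists>A. A \<subseteq> cube 0 n \<and> 0 \<in> A \<and> card A = n \<and> is_cluster A \<omega>"
      using origin_cluster_subset_cube[OF that] by (intro exI[of _ "origin_cluster \<omega>"]) (auto simp: is_cluster_origin)
  next
    assume "\<exists>A. A \<subseteq> cube 0 n \<and> 0 \<in> A \<and> card A = n \<and> is_cluster A \<omega>"
    then obtain A where "A \<subseteq> cube 0 n" "0 \<in> A" "card A = n" "is_cluster A \<omega>" by blast
    then show "cluster_size \<omega> = enat n"
      using finite_subset[OF _ finite_cube] by (auto simp: cluster_size_eq is_cluster_origin)
  qed
  then show ?thesis by (auto simp: space_P)
qed

lemma cluster_size_measurable: "event (\<lambda>\<omega>. cluster_size \<omega> = enat n) \<in> events"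
  unfolding cluster_size_event
  by (rule sets.finite_UN) (auto intro: is_cluster_measurable finite_subset[OF _ finite_cube])

lemma size_prob_eq: "size_prob n = (\<Sum>A\<in>clusters n. cluster_prob A)"
proof -
  let ?F = "{A. A \<subseteq> cube (0 :: 'n vertex) n \<and> 0 \<in> A \<and> card A = n}"
  have fin: "finite A" if "A \<in> ?F" for A using that finite_subset[OF _ finite_cube] by auto
  have "size_prob n = measure P (\<Union>A\<in>?F. event (is_cluster A))"
    unfolding size_prob_def cluster_size_event ..
  also have "\<dots> = (\<Sum>A\<in>?F. cluster_prob A)"
    unfolding cluster_prob_def
  proof (rule finite_measure_finite_Union)
    show "disjoint_family_on (\<lambda>A. event (is_cluster A)) ?F"
      by (auto simp: disjoint_family_on_def is_cluster_origin)
  qed (use fin is_cluster_measurable in auto)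
  also have "\<dots> = (\<Sum>A\<in>clusters n. cluster_prob A)"
  proof (rule sum.mono_neutral_right)
    show "clusters n \<subseteq> ?F" using clusters_subset_cube by (auto simp: clusters_def)
    show "\<forall>A\<in>?F - clusters n. cluster_prob A = 0"
    proof
      fix A assume A: "A \<in> ?F - clusters n"
      then have "\<not> cluster_prob A > 0" using fin[of A] by (simp add: clusters_def)
      then show "cluster_prob A = 0" using cluster_prob_nonneg[of A] by linarith
    qed
  qed auto
  finally show ?thesis .
qed

lemma exists_top:
  assumes "finite A" "A \<noteq> {}" shows "\<exists>x\<in>A. \<forall>a\<in>A. a $ i0 \<le> (x :: 'n vertex) $ i0"
proof -
  have "Max ((\<lambda>x. x $ i0) ` A) \<in> (\<lambda>x. x $ i0) ` A" using assms by (intro Max_in) auto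
  then obtain x where "x \<in> A" "x $ i0 = Max ((\<lambda>x. x $ i0) ` A)" by auto
  then show ?thesis using assms by (intro bexI[of _ x]) auto
qed

lemma exists_bottom:
  assumes "finite A" "A \<noteq> {}" shows "\<exists>x\<in>A. \<forall>a\<in>A. (x :: 'n vertex) $ i0 \<le> a $ i0"
proof -
  have "Min ((\<lambda>x. x $ i0) ` A) \<in> (\<lambda>x. x $ i0) ` A" using assms by (intro Min_in) auto
  then obtain x where "x \<in> A" "x $ i0 = Min ((\<lambda>x. x $ i0) ` A)" by auto
  then show ?thesis using assms by (intro bexI[of _ x]) auto
qed

text \<open>Both sides count triples of two clusters through the origin and a vertex \<open>v\<close> of their join: translating the
  join by \<open>-v\<close> gives a cluster \<open>W\<close> through the origin, and the triple is recovered from \<open>W\<close> and the new positions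
  of the two old origins, which lie in the two pieces of \<open>W\<close>.\<close>

lemma size_prob_join:
  assumes k: "k \<ge> 2"
  shows "link k * size_prob m * size_prob n * real (m + n + k) \<le> real m * real n * size_prob (m + n + k)"
proof -
  define i0 :: 'n where "i0 = undefined"
  obtain top :: "'n vertex set \<Rightarrow> 'n vertex" where
    top: "\<And>A. finite A \<Longrightarrow> A \<noteq> {} \<Longrightarrow> top A \<in> A \<and> (\<forall>a\<in>A. a $ i0 \<le> top A $ i0)"
    using exists_top[where ?i0.0 = i0] by metis
  obtain bot :: "'n vertex set \<Rightarrow> 'n vertex" where
    bot: "\<And>A. finite A \<Longrightarrow> A \<noteq> {} \<Longrightarrow> bot A \<in> A \<and> (\<forall>a\<in>A. bot A $ i0 \<le> a $ i0)"
    using exists_bottom[where ?i0.0 = i0] by metis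
  \<comment> \<open>The shift that puts the lowest vertex of \<open>B\<close> at the far end of the
    chain starting at the highest vertex of \<open>A\<close>.\<close>
  define off where "off A B = top A + axis i0 (int (Suc k)) - bot B" for A B
  define J where "J A B = A \<union> chain i0 (top A) k \<union> (+) (off A B) ` B" for A B
  have topA: "top A \<in> A" "\<And>a. a \<in> A \<Longrightarrow> a $ i0 \<le> top A $ i0" if "A \<in> clusters q" for A q
    using top[of A] that by (auto simp: clusters_def)
  have offB: "top A + axis i0 (int (Suc k)) \<in> (+) (off A B) ` B"
    "\<And>b. b \<in> (+) (off A B) ` B \<Longrightarrow> top A $ i0 + int (Suc k) \<le> b $ i0"
    if "B \<in> clusters q" for A B q
  proof -
    have b: "bot B \<in> B" "\<And>b. b \<in> B \<Longrightarrow> bot B $ i0 \<le> b $ i0"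
      using bot[of B] that by (auto simp: clusters_def)
    show "top A + axis i0 (int (Suc k)) \<in> (+) (off A B) ` B"
      using b(1) by (intro image_eqI[of _ _ "bot B"]) (auto simp: off_def)
    show "top A $ i0 + int (Suc k) \<le> b $ i0" if "b \<in> (+) (off A B) ` B" for b
      using that b(2) by (force simp: off_def axis_def)
  qed
  have chain_c: "top A $ i0 + 1 \<le> z $ i0" "z $ i0 \<le> top A $ i0 + int k" if "z \<in> chain i0 (top A) k" for z A
    using that by (auto simp: chain_def axis_def)
  have J1: "link k * cluster_prob A * cluster_prob B \<le> cluster_prob (J A B)"
    "finite (J A B)" "card (J A B) = m + n + k"
    "A = {w \<in> J A B. w $ i0 \<le> top A $ i0}"
    "(+) (off A B) ` B = {w \<in> J A B. top A $ i0 + int (Suc k) \<le> w $ i0}"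
    if A: "A \<in> clusters m" and B: "B \<in> clusters n" for A B
  proof -
    let ?B = "(+) (off A B) ` B"
    have ob: "top A + axis i0 (int (Suc k)) \<in> ?B"
      "b \<in> ?B \<Longrightarrow> top A $ i0 + int (Suc k) \<le> b $ i0" for b
      using offB[OF B] by blast+
    have ch: "z \<in> chain i0 (top A) k \<Longrightarrow> top A $ i0 + 1 \<le> z $ i0"
      "z \<in> chain i0 (top A) k \<Longrightarrow> z $ i0 \<le> top A $ i0 + int k" for z
      using chain_c by blast+
    have fin: "finite A" "finite B" "card A = m" "card B = n" using A B by (auto simp: clusters_def)
    show "link k * cluster_prob A * cluster_prob B \<le> cluster_prob (J A B)"
      using cluster_prob_join[of A ?B k "top A" i0] fin k topA[OF A] ob
      by (simp add: J_def cluster_prob_translate)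
    show "finite (J A B)" using fin by (simp add: J_def)
    show 1: "A = {w \<in> J A B. w $ i0 \<le> top A $ i0}"
      using topA[OF A] ch(1) ob(2) by (force simp: J_def)
    show 2: "?B = {w \<in> J A B. top A $ i0 + int (Suc k) \<le> w $ i0}"
      using topA[OF A] ch(2) ob(2) by (force simp: J_def)
    have "A \<inter> chain i0 (top A) k = {}" using topA(2)[OF A] ch(1) by force
    moreover have "(A \<union> chain i0 (top A) k) \<inter> ?B = {}"
      using topA(2)[OF A] ch(2) ob(2) by force
    ultimately show "card (J A B) = m + n + k"
      using fin by (simp add: J_def card_Un_disjoint card_chain card_image)
  qed
  define T where "T = (SIGMA A:clusters m. SIGMA B:clusters n. J A B)"
  define W where "W = (\<lambda>(A, B, v). (+) (- v) ` J A B)"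
  \<comment> \<open>After the translation by \<open>- v\<close>, the origin of \<open>A\<close> sits
    at \<open>- v\<close> and that of the shifted \<open>B\<close> at
    \<open>off A B - v\<close>.\<close>
  define \<phi> where "\<phi> = (\<lambda>(A, B, v). (W (A, B, v), - v, off A B - v))"
  \<comment> \<open>The left inverse: cut off the lowest \<open>m\<close> and the highest
    \<open>n\<close> vertices and move the two marked points back to the origin.\<close>
  define \<psi> where "\<psi> = (\<lambda>(V, a :: 'n vertex, b :: 'n vertex).
    ((+) (- a) ` slab_below i0 m V, (+) (- b) ` slab_above i0 n V, - a))"
  \<comment> \<open>For these sets the two pieces have the right sizes, so each carries exactly
    \<open>m * n\<close> pairs of marked points.\<close>
  define K where "K = {V \<in> clusters (m + n + k). card (slab_below i0 m V) = m \<and> card (slab_above i0 n V) = n}"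
  have finT: "finite T"
    unfolding T_def using finite_clusters J1(2) by (intro finite_SigmaI) auto
  have tr: "slab_below i0 m (W (A, B, v)) = (+) (- v) ` A"
    "slab_above i0 n (W (A, B, v)) = (+) (off A B - v) ` B"
    "link k * cluster_prob A * cluster_prob B \<le> cluster_prob (W (A, B, v))"
    "W (A, B, v) \<in> clusters (m + n + k)" "- v \<in> (+) (- v) ` A" "off A B - v \<in> (+) (off A B - v) ` B"
    "card A = m" "card B = n"
    if t: "(A, B, v) \<in> T" for A B v
  proof -
    have A: "A \<in> clusters m" and B: "B \<in> clusters n" and v: "v \<in> J A B" using t by (auto simp: T_def)
    note j = J1[OF A B]
    have cp: "cluster_prob (W (A, B, v)) = cluster_prob (J A B)"
      unfolding W_def prod.case by (rule cluster_prob_translate[OF j(2)])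
    show "card A = m" "card B = n" using A B by (auto simp: clusters_def)
    have "{w \<in> W (A, B, v). w $ i0 \<le> top A $ i0 - v $ i0} = (+) (- v) ` {w \<in> J A B. w $ i0 \<le> top A $ i0}"
      by (auto simp: W_def)
    then have 1: "{w \<in> W (A, B, v). w $ i0 \<le> top A $ i0 - v $ i0} = (+) (- v) ` A"
      using j(4) by simp
    show "slab_below i0 m (W (A, B, v)) = (+) (- v) ` A"
      unfolding 1[symmetric] by (rule slab_below_eq) (use j(2) 1 \<open>card A = m\<close> in \<open>auto simp: W_def card_image\<close>)
    have "{w \<in> W (A, B, v). top A $ i0 + int (Suc k) - v $ i0 \<le> w $ i0}
        = (+) (- v) ` {w \<in> J A B. top A $ i0 + int (Suc k) \<le> w $ i0}"
      by (auto simp: W_def)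
    also have "\<dots> = (+) (- v) ` (+) (off A B) ` B" using j(5) by simp
    also have "\<dots> = (+) (off A B - v) ` B" by (simp add: image_image algebra_simps)
    finally have 2: "{w \<in> W (A, B, v). top A $ i0 + int (Suc k) - v $ i0 \<le> w $ i0} = (+) (off A B - v) ` B" .
    show "slab_above i0 n (W (A, B, v)) = (+) (off A B - v) ` B"
      unfolding 2[symmetric] by (rule slab_above_eq) (use j(2) 2 \<open>card B = n\<close> in \<open>auto simp: W_def card_image\<close>)
    show le: "link k * cluster_prob A * cluster_prob B \<le> cluster_prob (W (A, B, v))"
      using j(1) cp by simp
    have "0 < link k * cluster_prob A * cluster_prob B"
      using A B link_pos by (simp add: clusters_def)
    then have "0 < cluster_prob (W (A, B, v))" using le by linarith
    moreover have "0 \<in> W (A, B, v)" using v by (auto simp: W_def image_iff)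
    ultimately show "W (A, B, v) \<in> clusters (m + n + k)"
      using j(2,3) by (simp add: clusters_def W_def card_image)
    show "- v \<in> (+) (- v) ` A" "off A B - v \<in> (+) (off A B - v) ` B"
      using A B by (auto simp: clusters_def image_iff)
  qed
  have inj: "inj_on \<phi> T"
  proof (rule inj_on_inverseI[where g = \<psi>])
    fix t assume "t \<in> T"
    moreover obtain A B v where "t = (A, B, v)" by (cases t)
    ultimately show "\<psi> (\<phi> t) = t"
      by (simp add: \<phi>_def \<psi>_def tr(1,2) image_image)
  qed
  have img: "\<phi> ` T \<subseteq> (SIGMA V:K. slab_below i0 m V \<times> slab_above i0 n V)"
  proof
    fix y assume "y \<in> \<phi> ` T"
    then obtain A B v where t: "(A, B, v) \<in> T" and y: "y = \<phi> (A, B, v)" by (metis imageE prod_cases3)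
    show "y \<in> (SIGMA V:K. slab_below i0 m V \<times> slab_above i0 n V)"
      using tr[OF t] by (auto simp: y \<phi>_def K_def card_image)
  qed
  have finV: "finite V" if "V \<in> K" for V using that by (auto simp: K_def clusters_def)
  then have finS: "finite (slab_below i0 m V)" "finite (slab_above i0 n V)" if "V \<in> K" for V
    using that by (auto simp: slab_below_def slab_above_def)
  have finK: "finite K" using finite_clusters by (simp add: K_def)
  have "link k * size_prob m * size_prob n * real (m + n + k)
      = (\<Sum>A\<in>clusters m. \<Sum>B\<in>clusters n. real (m + n + k) * (link k * cluster_prob A * cluster_prob B))"
    by (simp add: size_prob_eq sum_product sum_distrib_left sum_distrib_right mult_ac)
  \<comment> \<open>The factor \<open>m + n + k\<close> is the number of choices of \<open>v\<close>
    in the join.\<close>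
  also have "\<dots> = (\<Sum>A\<in>clusters m. \<Sum>B\<in>clusters n. \<Sum>v\<in>J A B. link k * cluster_prob A * cluster_prob B)"
    using J1(3) by (intro sum.cong refl) simp
  also have "\<dots> = (\<Sum>A\<in>clusters m. \<Sum>(B, v)\<in>(SIGMA B:clusters n. J A B). link k * cluster_prob A * cluster_prob B)"
    using finite_clusters J1(2) by (intro sum.cong refl sum.Sigma) auto
  also have "\<dots> = (\<Sum>(A, B, v)\<in>T. link k * cluster_prob A * cluster_prob B)"
    unfolding T_def using finite_clusters J1(2) by (intro sum.Sigma) auto
  also have "\<dots> \<le> (\<Sum>t\<in>T. cluster_prob (W t))"
    using tr(3) by (intro sum_mono) auto
  also have "\<dots> = (\<Sum>t\<in>T. cluster_prob (fst (\<phi> t)))"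
    by (intro sum.cong) (auto simp: \<phi>_def)
  also have "\<dots> = (\<Sum>y\<in>\<phi> ` T. cluster_prob (fst y))"
    by (simp add: sum.reindex[OF inj])
  also have "\<dots> \<le> (\<Sum>y\<in>(SIGMA V:K. slab_below i0 m V \<times> slab_above i0 n V). cluster_prob (fst y))"
    using finK finS by (intro sum_mono2 img cluster_prob_nonneg) auto
  also have "\<dots> = (\<Sum>V\<in>K. \<Sum>ab\<in>slab_below i0 m V \<times> slab_above i0 n V. cluster_prob V)"
    using finK finS by (subst sum.Sigma) (auto simp: case_prod_unfold)
  also have "\<dots> = (\<Sum>V\<in>K. real m * real n * cluster_prob V)"
    by (intro sum.cong refl) (simp add: K_def card_cartesian_product)
  also have "\<dots> \<le> (\<Sum>V\<in>clusters (m + n + k). real m * real n * cluster_prob V)"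
    using finite_clusters cluster_prob_nonneg by (intro sum_mono2) (auto simp: K_def)
  also have "\<dots> = real m * real n * size_prob (m + n + k)"
    by (simp add: size_prob_eq sum_distrib_left)
  finally show ?thesis .
qed

end

section \<open>The limit\<close>

text \<open>Fekete's lemma for \<open>- ln (v n)\<close>. Since \<open>v\<close> may vanish below
  \<open>N\<close>, the infimum defining the limit runs only over indices with positive
  values.\<close>

lemma supermultiplicative_limit:
  fixes v :: "nat \<Rightarrow> real"
  assumes nonneg: "\<And>n. 0 \<le> v n" and le1: "\<And>n. v n \<le> 1"
    and super: "\<And>m n. v m * v n \<le> v (m + n)" and pos: "\<And>n. n \<ge> N \<Longrightarrow> 0 < v n"
  shows "\<exists>\<zeta>\<ge>0. (\<lambda>n. - ln (v n) / real n) \<longlonglongrightarrow> \<zeta> \<and> (\<forall>n. v n \<le> exp (- real n * \<zeta>))"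
proof -
  define g where "g n = - ln (v n)" for n
  define Z where "Z = {g n / real n | n. n \<ge> 1 \<and> v n > 0}"
  define \<zeta> where "\<zeta> = Inf Z"
  have g0: "0 \<le> g n" if "v n > 0" for n using that le1[of n] by (simp add: g_def)
  have Z0: "0 \<le> z" if "z \<in> Z" for z using that g0 by (auto simp: Z_def)
  have Zne: "Z \<noteq> {}" using pos[of "Suc N"] unfolding Z_def by fastforce
  have bdd: "bdd_below Z" using Z0 by (auto simp: bdd_below_def)
  have z0: "\<zeta> \<ge> 0" unfolding \<zeta>_def using Zne Z0 by (intro cInf_greatest) auto
  have lower: "\<zeta> \<le> g n / real n" if "n \<ge> 1" "v n > 0" for n
    unfolding \<zeta>_def using that by (intro cInf_lower bdd) (auto simp: Z_def)
  have up: "v n \<le> exp (- real n * \<zeta>)" for n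
  proof (cases "n \<ge> 1 \<and> v n > 0")
    case True
    then have "real n * \<zeta> \<le> g n" using lower[of n] by (simp add: field_simps)
    then have "ln (v n) \<le> - real n * \<zeta>" by (simp add: g_def)
    then have "exp (ln (v n)) \<le> exp (- real n * \<zeta>)" by (simp only: exp_le_cancel_iff)
    then show ?thesis using True by simp
  next
    case False
    then have "n = 0 \<or> v n = 0" using nonneg[of n] by auto
    then show ?thesis using le1[of n] by auto
  qed
  have pow: "v k ^ q * v r \<le> v (q * k + r)" for k q r
  proof (induction q)
    case (Suc q)
    have "v k ^ Suc q * v r = v k * (v k ^ q * v r)" by simp
    also have "\<dots> \<le> v k * v (q * k + r)" using Suc nonneg by (intro mult_left_mono) auto
    also have "\<dots> \<le> v (k + (q * k + r))" by (rule super)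
    finally show ?case by (simp add: algebra_simps)
  qed simp
  have lim: "(\<lambda>n. g n / real n) \<longlonglongrightarrow> \<zeta>"
  proof (rule LIMSEQ_I)
    fix e :: real assume e: "0 < e"
    obtain z where z: "z \<in> Z" "z < \<zeta> + e / 2"
      using cInf_lessD[of Z "\<zeta> + e / 2"] Zne e by (auto simp: \<zeta>_def)
    then obtain k where k: "k \<ge> 1" "v k > 0" "g k / real k < \<zeta> + e / 2" by (auto simp: Z_def)
    \<comment> \<open>A bound on the cost of every possible remainder; divided by \<open>n\<close>
      it becomes negligible.\<close>
    define G where "G = (\<Sum>r\<in>{N..<N + k}. g r)"
    have gG: "g r \<le> G" if "r \<in> {N..<N + k}" for r
      unfolding G_def by (rule member_le_sum) (use that pos g0 in auto)
    obtain M :: nat where M: "real M > 2 * G / e" using reals_Archimedean2 by blast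
    have "norm (g n / real n - \<zeta>) < e" if n: "n \<ge> max (Suc N) (Suc M)" for n
    proof -
      define q where "q = (n - N) div k"
      \<comment> \<open>The remainder is raised by \<open>N\<close> so that
        \<open>v r > 0\<close>.\<close>
      define r where "r = N + (n - N) mod k"
      have nq: "n = q * k + r"
        using n div_mult_mod_eq[of "n - N" k] unfolding q_def r_def by linarith
      have r: "r \<in> {N..<N + k}" using k(1) by (auto simp: r_def)
      have vr: "v r > 0" using r pos by auto
      have "0 < v k ^ q * v r" using k vr by simp
      then have "ln (v k ^ q * v r) \<le> ln (v n)" using pow[of k q r] nq by simp
      then have "g n \<le> real q * g k + g r"
        using k(2) vr by (simp add: g_def ln_mult ln_realpow)
      also have "\<dots> \<le> real q * g k + G" using gG[OF r] by simp
      finally have gn: "g n \<le> real q * g k + G" .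
      have n0: "real n > 0" using n by simp
      have "real q * g k = real (q * k) * (g k / real k)" using k(1) by simp
      also have "\<dots> \<le> real n * (g k / real k)"
        using nq g0[OF k(2)] k(1) by (intro mult_right_mono) auto
      also have "\<dots> \<le> real n * (\<zeta> + e / 2)"
        using k(3) n0 by (intro mult_left_mono) auto
      finally have "g n \<le> real n * (\<zeta> + e / 2) + G" using gn by linarith
      moreover have "G < real n * (e / 2)"
      proof -
        have "2 * G / e < real n" using M n by linarith
        then show ?thesis using e by (simp add: field_simps)
      qed
      ultimately have "g n < real n * (\<zeta> + e)" by (simp add: algebra_simps)
      then have "g n / real n < \<zeta> + e" using n0 by (simp add: field_simps)
      moreover have "\<zeta> \<le> g n / real n" using lower[of n] n pos[of n] by auto
      ultimately show ?thesis using e by (simp add: abs_if)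
    qed
    then show "\<exists>no. \<forall>n\<ge>no. norm (g n / real n - \<zeta>) < e" by blast
  qed
  show ?thesis
    using z0 lim up by (intro exI[of _ \<zeta>]) (simp add: g_def)
qed

context degenerate_environment
begin

lemma size_prob_nonneg: "size_prob n \<ge> 0"
  by (simp add: size_prob_def)

lemma size_prob_le_1: "size_prob n \<le> 1"
  by (simp add: size_prob_def)

text \<open>The unit square, each vertex pointing to its two neighbours in the square, is a possible cluster: by parity
  no vertex has more than two neighbours in it.\<close>

lemma size_prob_4_pos: "size_prob 4 > 0"
proof -
  obtain i j :: 'n where ij: "i \<noteq> j"
    using dim card_le_Suc0_iff_eq[of "UNIV :: 'n set"] by auto
  define ei :: "'n vertex" where "ei = axis i 1"
  define ej :: "'n vertex" where "ej = axis j 1"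
  define S where "S = {0, ei, ej, ei + ej}"
  \<comment> \<open>Neighbours have coordinate sums of opposite parity, so a vertex can be adjacent
    to only one of the two diagonals of the square.\<close>
  define par :: "'n vertex \<Rightarrow> int" where "par z = (\<Sum>l\<in>UNIV. z $ l)" for z
  have par_add: "par (x + y) = par x + par y" for x y by (simp add: par_def sum.distrib)
  have par_axis: "par (axis l s) = s" for l s by (simp add: par_def axis_def)
  have par_nb: "even (par y) \<longleftrightarrow> odd (par z)" if "y \<in> nbrs z" for y z
    using that by (elim nbrs_cases) (auto simp: par_add par_axis)
  have pars: "par 0 = 0" "par ei = 1" "par ej = 1" "par (ei + ej) = 2"
    by (auto simp: ei_def ej_def par_add par_axis) (simp add: par_def)
  have ne: "ei \<noteq> ej" "ei \<noteq> 0" "ej \<noteq> 0" "ei + ej \<noteq> 0" "ei + ej \<noteq> ei" "ei + ej \<noteq> ej"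
    using ij pars by (auto simp: ei_def ej_def axis_eq_axis)
  have cS: "card S = 4" using ne by (auto simp: S_def)
  have le2: "card (nbrs z \<inter> S) \<le> 2" for z
  proof -
    have "nbrs z \<inter> S \<subseteq> {0, ei + ej} \<or> nbrs z \<inter> S \<subseteq> {ei, ej}"
    proof (cases "odd (par z)")
      case True
      then have "even (par y)" if "y \<in> nbrs z" for y using par_nb[OF that] by simp
      then have "ei \<notin> nbrs z" "ej \<notin> nbrs z" using pars by fastforce+
      then show ?thesis by (auto simp: S_def)
    next
      case False
      then have "odd (par y)" if "y \<in> nbrs z" for y using par_nb[OF that] by simp
      then have "0 \<notin> nbrs z" "ei + ej \<notin> nbrs z" using pars by fastforce+
      then show ?thesis by (auto simp: S_def)
    qed
    then show ?thesis
    proof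
      assume "nbrs z \<inter> S \<subseteq> {0, ei + ej}"
      then have "card (nbrs z \<inter> S) \<le> card {0, ei + ej}" by (intro card_mono) auto
      then show ?thesis using ne by simp
    next
      assume "nbrs z \<inter> S \<subseteq> {ei, ej}"
      then have "card (nbrs z \<inter> S) \<le> card {ei, ej}" by (intro card_mono) auto
      then show ?thesis using ne by simp
    qed
  qed
  have nb: "ei \<in> nbrs 0" "ej \<in> nbrs 0" "ei + ej \<in> nbrs ei" "ei + ej \<in> nbrs ej"
    using nbrsI[of 1 0 i] nbrsI[of 1 0 j] nbrsI[of 1 ei j] nbrsI[of 1 ej i]
    by (auto simp: ei_def ej_def add.commute)
  then have nb': "0 \<in> nbrs ei" "0 \<in> nbrs ej" "ei \<in> nbrs (ei + ej)" "ej \<in> nbrs (ei + ej)"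
    by (auto simp: nbrs_sym[of _ "ei + ej"] nbrs_sym[of 0])
  have ge2: "card (nbrs z \<inter> S) = 2" if "z \<in> S" for z
  proof -
    have "\<exists>u w. u \<noteq> w \<and> {u, w} \<subseteq> nbrs z \<inter> S"
    proof -
      consider "z = 0" | "z = ei" | "z = ej" | "z = ei + ej" using \<open>z \<in> S\<close> by (auto simp: S_def)
      then show ?thesis
      proof cases
        case 1 then show ?thesis using nb nb' ne by (intro exI[of _ ei] exI[of _ ej]) (auto simp: S_def)
      next
        case 2 then show ?thesis using nb nb' ne by (intro exI[of _ 0] exI[of _ "ei + ej"]) (auto simp: S_def)
      next
        case 3 then show ?thesis using nb nb' ne by (intro exI[of _ 0] exI[of _ "ei + ej"]) (auto simp: S_def)
      next
        case 4 then show ?thesis using nb nb' ne by (intro exI[of _ ei] exI[of _ ej]) (auto simp: S_def)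
      qed
    qed
    then obtain u w where "u \<noteq> w" "{u, w} \<subseteq> nbrs z \<inter> S" by blast
    then have "2 \<le> card (nbrs z \<inter> S)" using card_mono[of "nbrs z \<inter> S" "{u, w}"] by simp
    then show ?thesis using le2[of z] by simp
  qed
  define X where "X z = (if z \<in> S then {nbrs z \<inter> S} else {T \<in> Pow (nbrs z). T \<inter> S = {}})" for z
  have fin: "finite (nbhd S)" by (simp add: S_def)
  have "0 < measure (state_measure p z) (X z)" for z
  proof (cases "z \<in> S")
    case True
    then show ?thesis using ge2[OF True] weight_2_pos by (simp add: X_def measure_state_single)
  next
    case False
    then have "X z = {T \<in> Pow (nbrs z). T \<inter> (nbrs z \<inter> S) = {}}" by (auto simp: X_def)
    then have "measure (state_measure p z) (X z) = avoid (card (nbrs z \<inter> S))"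
      using measure_state_avoid[of "nbrs z \<inter> S" z] by simp
    then show ?thesis using avoid_antimono[OF le2[of z]] avoid_2_pos d_ge by simp
  qed
  then have "0 < (\<Prod>z\<in>nbhd S. measure (state_measure p z) (X z))" by (intro prod_pos) auto
  also have "\<dots> = Pr (\<lambda>\<omega>. \<forall>z\<in>nbhd S. \<omega> z \<in> X z)"
    by (rule cylinder_event(2)[symmetric, OF fin]) (auto simp: X_def)
  also have "\<dots> \<le> cluster_prob S"
    unfolding cluster_prob_def
  proof (rule Pr_mono)
    show "event (is_cluster S) \<in> events" by (rule is_cluster_measurable) (simp add: S_def)
    fix \<omega> assume leg: "legal \<omega>" and w: "\<forall>z\<in>nbhd S. \<omega> z \<in> X z"
    have in_S: "\<omega> z = nbrs z \<inter> S" if "z \<in> S" for z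
    proof -
      have "z \<in> nbhd S" using that by (simp add: nbhd_def)
      then have "\<omega> z \<in> X z" using w by blast
      then show ?thesis using that by (simp add: X_def)
    qed
    show "is_cluster S \<omega>"
    proof (rule is_clusterI[of 0])
      show "0 \<in> S" by (simp add: S_def)
      show "\<omega> a \<subseteq> S" if "a \<in> S" for a using in_S[OF that] by auto
      show "\<omega> z \<inter> S = {}" if z: "z \<notin> S" for z
      proof (cases "z \<in> nbhd S")
        case True
        then have "\<omega> z \<in> X z" using w by blast
        then show ?thesis using z by (simp add: X_def)
      next
        case False
        then have "nbrs z \<inter> S = {}" using nbrs_sym by (auto simp: nbhd_def)
        then show ?thesis using leg unfolding legal_def by blast
      qed
      have S4: "0 \<in> S" "ei \<in> S" "ej \<in> S" "ei + ej \<in> S" by (auto simp: S_def)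
      have "(0, ei) \<in> local_edges UNIV \<omega>" "(0, ej) \<in> local_edges UNIV \<omega>" "(ei, ei + ej) \<in> local_edges UNIV \<omega>"
        using in_S S4 nb by (auto simp: local_edges_def)
      then have "ei \<in> cluster_in UNIV \<omega> 0" "ej \<in> cluster_in UNIV \<omega> 0" "ei + ej \<in> cluster_in UNIV \<omega> 0"
        using cluster_in_step[of _ UNIV \<omega> 0] cluster_in_self[of 0 UNIV \<omega>] by blast+
      then show "S \<subseteq> cluster_in UNIV \<omega> 0" by (simp add: S_def)
    qed
  qed
  finally have pos: "0 < cluster_prob S" .
  have "finite S" by (simp add: S_def)
  then have "S \<in> clusters 4" using pos cS by (simp add: clusters_def) (simp add: S_def)
  then have "cluster_prob S \<le> size_prob 4"
    unfolding size_prob_eq by (intro member_le_sum finite_clusters cluster_prob_nonneg) auto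
  then show ?thesis using pos by linarith
qed

text \<open>Two unit squares are joined by a chain of \<open>n - 8\<close> vertices;
  \<open>n >= 10\<close> makes this chain long enough for \<open>size_prob_join\<close>.\<close>

lemma size_prob_pos:
  assumes "n \<ge> 10" shows "size_prob n > 0"
proof -
  have n: "4 + 4 + (n - 8) = n" using assms by simp
  have "link (n - 8) * size_prob 4 * size_prob 4 * real n \<le> real 4 * real 4 * size_prob n"
    using size_prob_join[of "n - 8" 4 4] assms unfolding n by simp
  moreover have "0 < link (n - 8) * size_prob 4 * size_prob 4 * real n"
    using link_pos size_prob_4_pos assms by simp
  ultimately show ?thesis by simp
qed

lemma link_2_le_1: "link 2 \<le> 1"
  unfolding link_def using weight_2_le_1 weight_2_pos avoid_le_1[of 2] avoid_2_pos d_ge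
  by (intro mult_le_one power_le_one) auto

text \<open>Dividing by \<open>n\<close> removes the factors of \<open>size_prob_join\<close>, and
  shifting the index by 2 absorbs the chain vertices, as
  \<open>a + b - 2 = (a - 2) + (b - 2) + 2\<close>. Fekete's lemma then applies.\<close>

lemma size_prob_limit:
  "\<exists>\<zeta>\<ge>0. (\<lambda>n. - ln (size_prob n) / real n) \<longlonglongrightarrow> \<zeta>
    \<and> (\<forall>n\<ge>1. size_prob n \<le> real n / link 2 * exp (- real n * \<zeta>))"
proof -
  define v where "v n = (if n \<ge> 3 then link 2 * size_prob (n - 2) / real (n - 2) else 0)" for n
  have v0: "0 \<le> v n" for n
    using link_pos[of 2] size_prob_nonneg by (simp add: v_def)
  have v1: "v n \<le> 1" for n
  proof (cases "n \<ge> 3")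
    case True
    have "link 2 * size_prob (n - 2) \<le> 1"
      using link_pos[of 2] link_2_le_1 size_prob_nonneg size_prob_le_1 by (intro mult_le_one) auto
    also have "1 \<le> real (n - 2)" using True by simp
    finally show ?thesis using True by (simp add: v_def divide_le_eq)
  qed (simp add: v_def)
  have v2: "v a * v b \<le> v (a + b)" for a b
  proof (cases "a \<ge> 3 \<and> b \<ge> 3")
    case True
    define m n where "m = a - 2" "n = b - 2"
    have mn: "m \<ge> 1" "n \<ge> 1" "a + b - 2 = m + n + 2" using True by (auto simp: m_n_def)
    have "v a * v b = link 2 * (link 2 * size_prob m * size_prob n) / (real m * real n)"
      using True by (simp add: v_def m_n_def)
    also have "\<dots> \<le> link 2 * (real m * real n * size_prob (m + n + 2) / real (m + n + 2)) / (real m * real n)"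
      using size_prob_join[of 2 m n] mn link_pos[of 2]
      by (intro divide_right_mono mult_left_mono) (auto simp: pos_le_divide_eq)
    also have "\<dots> = v (a + b)"
      using True mn(1,2) by (simp add: v_def mn(3))
    finally show ?thesis .
  next
    case False
    then have "v a * v b = 0" by (auto simp: v_def)
    then show ?thesis using v0[of "a + b"] by metis
  qed
  have v3: "0 < v n" if "n \<ge> 12" for n
    using that size_prob_pos[of "n - 2"] link_pos[of 2] by (simp add: v_def)
  obtain \<zeta> where z: "\<zeta> \<ge> 0" "(\<lambda>n. - ln (v n) / real n) \<longlonglongrightarrow> \<zeta>" "\<And>n. v n \<le> exp (- real n * \<zeta>)"
    using supermultiplicative_limit[of v 12] v0 v1 v2 v3 by blast
  have "size_prob n \<le> real n / link 2 * exp (- real n * \<zeta>)" if n: "n \<ge> 1" for n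
  proof -
    have "link 2 * size_prob n / real n = v (n + 2)" using n by (simp add: v_def)
    also have "\<dots> \<le> exp (- real (n + 2) * \<zeta>)" by (rule z(3))
    also have "\<dots> \<le> exp (- real n * \<zeta>)" using z(1) by (simp add: algebra_simps)
    finally show ?thesis using n link_pos[of 2] by (simp add: field_simps)
  qed
  moreover have "(\<lambda>n. - ln (size_prob n) / real n) \<longlonglongrightarrow> \<zeta>"
  proof -
    \<comment> \<open>The shift, the constant \<open>link 2\<close> and the factor
      \<open>1 / n\<close> alter the normalised logarithm only by terms tending to 0.\<close>
    have "(\<lambda>n. - ln (v (n + 2)) / real (n + 2)) \<longlonglongrightarrow> \<zeta>"
      using LIMSEQ_ignore_initial_segment[OF z(2), of 2] .
    moreover have "(\<lambda>n. real (n + 2) / real n) \<longlonglongrightarrow> 1" by real_asymp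
    moreover have "(\<lambda>n. (ln (link 2) - ln (real n)) / real n) \<longlonglongrightarrow> 0"
    proof -
      have "(\<lambda>n. 1 / real n) \<longlonglongrightarrow> 0" "(\<lambda>n. ln (real n) / real n) \<longlonglongrightarrow> 0" by real_asymp+
      then have "(\<lambda>n. ln (link 2) * (1 / real n) - ln (real n) / real n) \<longlonglongrightarrow> ln (link 2) * 0 - 0"
        by (intro tendsto_intros)
      then show ?thesis by (simp add: diff_divide_distrib)
    qed
    ultimately have "(\<lambda>n. - ln (v (n + 2)) / real (n + 2) * (real (n + 2) / real n)
        + (ln (link 2) - ln (real n)) / real n) \<longlonglongrightarrow> \<zeta> * 1 + 0"
      by (intro tendsto_intros)
    then have "(\<lambda>n. - ln (v (n + 2)) / real (n + 2) * (real (n + 2) / real n)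
        + (ln (link 2) - ln (real n)) / real n) \<longlonglongrightarrow> \<zeta>" by simp
    then show ?thesis
    proof (rule Lim_transform_eventually)
      show "\<forall>\<^sub>F n in sequentially. - ln (v (n + 2)) / real (n + 2) * (real (n + 2) / real n)
        + (ln (link 2) - ln (real n)) / real n = - ln (size_prob n) / real n"
        using eventually_ge_at_top[of 10]
      proof eventually_elim
        case (elim n)
        have "ln (v (n + 2)) = ln (link 2) + ln (size_prob n) - ln (real n)"
          using elim size_prob_pos[of n] link_pos[of 2] by (simp add: v_def ln_mult ln_div)
        moreover have "- ln (v (n + 2)) / real (n + 2) * (real (n + 2) / real n) = - ln (v (n + 2)) / real n"
        proof -
          have "y / a * (a / b) = y / b" if "a \<noteq> 0" for y a b :: real using that by simp
          then show ?thesis using of_nat_neq_0[of "Suc n", where ?'a = real] by (metis add_2_eq_Suc')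
        qed
        ultimately show ?case by (simp add: diff_divide_distrib add_divide_distrib)
      qed
    qed
  qed
  ultimately show ?thesis using z(1) by blast
qed

end

section \<open>Exponential decay when the mean cluster size is finite\<close>

primrec visited :: "'n::finite vertex \<Rightarrow> 'n vertex list \<Rightarrow> 'n vertex set" where
  "visited x [] = {x}"
| "visited x (t # ts) = insert x (visited (x + t) ts)"

lemma visited_start: "x \<in> visited x ts"
  by (cases ts) auto

lemma finite_visited [simp]: "finite (visited x ts)"
  by (induction ts arbitrary: x) auto

text \<open>Stepping from \<open>s\<close> to \<open>s + t\<close> and straight back adds one vertex
  for two steps and leaves the rest of the walk unchanged.\<close>

lemma visited_detour:
  assumes "s \<in> visited x ts"
  shows "\<exists>us. length us = length ts + 2 \<and> set us \<subseteq> set ts \<union> {t, - t} \<and> visited x us = insert (s + t) (visited x ts)"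
  using assms
proof (induction ts arbitrary: x)
  case Nil
  then show ?case by (intro exI[of _ "[t, - t]"]) auto
next
  case (Cons a ts)
  show ?case
  proof (cases "s = x")
    case True
    then show ?thesis by (intro exI[of _ "t # - t # a # ts"]) auto
  next
    case False
    then have "s \<in> visited (x + a) ts" using Cons.prems by auto
    then obtain us where "length us = length ts + 2" "set us \<subseteq> set ts \<union> {t, - t}"
      "visited (x + a) us = insert (s + t) (visited (x + a) ts)" using Cons.IH by blast
    then show ?thesis by (intro exI[of _ "a # us"]) auto
  qed
qed

definition separated :: "nat \<Rightarrow> 'n::finite vertex set \<Rightarrow> bool" where
  "separated R S \<longleftrightarrow> (\<forall>s\<in>S. \<forall>t\<in>S. s \<noteq> t \<longrightarrow> t \<notin> cube s R)"

text \<open>Greedy choice: while the balls of radius \<open>R\<close> around the visited vertices do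
  not cover \<open>C\<close>, some edge of \<open>C\<close> leaves their union. Its outer end is
  within \<open>R + 1\<close> of a visited vertex, and a detour from there adds it.\<close>

lemma walk_through_cluster:
  fixes x :: "'n::finite vertex"
  assumes "legal \<omega>" and C: "C = cluster_in UNIV \<omega> x" and "k * card (cube (0 :: 'n vertex) R) < card C"
  shows "\<exists>ts. length ts = 2 * k \<and> set ts \<subseteq> cube 0 (Suc R) \<and> visited x ts \<subseteq> C
    \<and> card (visited x ts) = Suc k \<and> separated R (visited x ts)"
  using assms(3)
proof (induction k)
  case 0
  show ?case by (intro exI[of _ "[]"]) (auto simp: C separated_def)
next
  case (Suc k)
  then obtain ts where ts: "length ts = 2 * k" "set ts \<subseteq> cube 0 (Suc R)" "visited x ts \<subseteq> C"
    "card (visited x ts) = Suc k" "separated R (visited x ts)" by auto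
  let ?H = "\<Union>s\<in>visited x ts. cube s R"
  have "card ?H \<le> (\<Sum>s\<in>visited x ts. card (cube s R))" by (rule card_UN_le) simp
  also have "\<dots> = Suc k * card (cube (0 :: 'n vertex) R)" by (subst card_cube_eq) (simp add: ts(4))
  finally have "card ?H < card C" using Suc.prems by simp
  then have nsub: "\<not> C \<subseteq> ?H" using card_mono[of ?H C] by auto
  have "\<exists>a b. a \<in> C \<inter> ?H \<and> (a, b) \<in> local_edges UNIV \<omega> \<and> b \<notin> C \<inter> ?H"
  proof (rule ccontr)
    assume no: "\<not> ?thesis"
    have "x \<in> C \<inter> ?H" using visited_start[of x ts] C cluster_in_self cube_self by blast
    then have "cluster_in UNIV \<omega> x \<subseteq> C \<inter> ?H" by (rule cluster_in_subset) (use no in blast)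
    then show False using nsub C by blast
  qed
  then obtain a b where ab: "a \<in> C" "a \<in> ?H" "(a, b) \<in> local_edges UNIV \<omega>" "b \<notin> C \<inter> ?H" by blast
  have "b \<in> C" using ab(1,3) C cluster_in_step by blast
  then have bH: "b \<notin> ?H" using ab(4) by blast
  obtain s where s: "s \<in> visited x ts" "a \<in> cube s R" using ab(2) by blast
  have "b \<in> cube a 1" using ab(3) assms(1) local_edges_nbrs nbrs_subset_cube by blast
  then have "b \<in> cube s (Suc R)" using cube_triangle[OF s(2), of b 1] by simp
  then have t: "b - s \<in> cube 0 (Suc R)" "- (b - s) \<in> cube 0 (Suc R)"
    by (auto simp: cube_def abs_minus_commute)
  obtain us where us: "length us = length ts + 2" "set us \<subseteq> set ts \<union> {b - s, - (b - s)}"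
    "visited x us = insert (s + (b - s)) (visited x ts)"
    using visited_detour[OF s(1), of "b - s"] by blast
  have vis: "visited x us = insert b (visited x ts)" using us(3) by simp
  have "b \<notin> visited x ts" using bH cube_self by blast
  then have "card (visited x us) = Suc (Suc k)" by (simp add: vis ts(4))
  moreover have "separated R (visited x us)"
    using ts(5) bH unfolding separated_def vis by (auto simp: cube_sym)
  moreover have "length us = 2 * Suc k" using us(1) ts(1) by simp
  moreover have "set us \<subseteq> cube 0 (Suc R)" using us(2) ts(2) t by blast
  moreover have "visited x us \<subseteq> C" using vis ts(3) \<open>b \<in> C\<close> by simp
  ultimately show ?case by blast
qed

section \<open>Exploration in a box and independent restarts\<close>

definition thicken :: "'n::finite vertex set \<Rightarrow> 'n vertex set" where
  "thicken A = (\<Union>a\<in>A. cube a 2)"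

lemma finite_thicken [simp]: "finite A \<Longrightarrow> finite (thicken A)"
  by (simp add: thicken_def)

lemma card_thicken:
  assumes "finite A" shows "card (thicken (A :: 'n::finite vertex set)) \<le> card (cube (0 :: 'n vertex) 2) * card A"
proof -
  have "card (thicken A) \<le> (\<Sum>a\<in>A. card (cube a 2))"
    unfolding thicken_def using assms by (rule card_UN_le)
  also have "\<dots> = card (cube (0 :: 'n vertex) 2) * card A" by (subst card_cube_eq) simp
  finally show ?thesis .
qed

text \<open>The remaining clusters only use vertex states that are independent of the event that \<open>A\<close> was found by
  exploring inside \<open>F\<close>; starting them from all of \<open>thicken A\<close> makes up for the states next to \<open>A\<close>, which carry
  information on \<open>A\<close>.\<close>

lemma cluster_subset_fresh:
  assumes "legal \<omega>" "cluster_in F \<omega> x = A"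
  shows "cluster_in UNIV \<omega> x \<subseteq> (\<Union>v\<in>thicken A. cluster_in (- nbhd A) \<omega> v)"
proof (rule cluster_in_subset)
  have "x \<in> thicken A" using assms(2) cluster_in_self[of x F \<omega>] cube_self unfolding thicken_def by blast
  then show "x \<in> (\<Union>v\<in>thicken A. cluster_in (- nbhd A) \<omega> v)" using cluster_in_self by blast
  fix a b assume a: "a \<in> (\<Union>v\<in>thicken A. cluster_in (- nbhd A) \<omega> v)" and ab: "(a, b) \<in> local_edges UNIV \<omega>"
  show "b \<in> (\<Union>v\<in>thicken A. cluster_in (- nbhd A) \<omega> v)"
  proof (cases "(a, b) \<in> local_edges (- nbhd A) \<omega>")
    case True
    then show ?thesis using a cluster_in_step by blast
  next
    \<comment> \<open>The edge has an endpoint in \<open>nbhd A\<close>, so \<open>b\<close> is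
      within distance 2 of \<open>A\<close> and is itself a starting point.\<close>
    case False
    have nb: "b \<in> nbrs a" using ab assms(1) local_edges_nbrs by blast
    have "a \<in> nbhd A \<or> b \<in> nbhd A" using False ab by (auto simp: local_edges_def)
    then obtain w where w: "w \<in> nbhd A" "b \<in> cube w 1"
      using nb nbrs_subset_cube[of a] cube_self[of b 1] by blast
    from w(1) obtain c where "c \<in> A" "w \<in> cube c 1"
      unfolding nbhd_def using nbrs_subset_cube cube_self by blast
    then have "b \<in> thicken A" using cube_triangle[of w c 1 b 1] w(2) by (auto simp: thicken_def numeral_2_eq_2)
    then show ?thesis using cluster_in_self by blast
  qed
qed

context degenerate_environment
begin

lemma Pr_le_sum:
  assumes "finite I" "\<And>i. i \<in> I \<Longrightarrow> event (R i) \<in> events" "\<And>\<omega>. legal \<omega> \<Longrightarrow> Q \<omega> \<Longrightarrow> \<exists>i\<in>I. R i \<omega>"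
  shows "Pr Q \<le> (\<Sum>i\<in>I. Pr (R i))"
proof -
  have "Pr Q \<le> measure P (\<Union>i\<in>I. event (R i))"
    using assms by (intro finite_measure_mono) (auto simp: space_P)
  also have "\<dots> \<le> (\<Sum>i\<in>I. Pr (R i))"
    using assms by (intro finite_measure_subadditive_finite) auto
  finally show ?thesis .
qed

text \<open>Reading only states near \<open>v\<close> makes this a finite-range event; by
  \<open>not_in_cube_local\<close> it still says, for legal configurations, that the whole cluster
  in \<open>F\<close> leaves \<open>cube v l\<close>.\<close>

definition escapes :: "'n vertex set \<Rightarrow> nat \<Rightarrow> 'n vertex \<Rightarrow> 'n config \<Rightarrow> bool" where
  "escapes F l v \<omega> \<longleftrightarrow> \<not> cluster_in (F \<inter> cube v (Suc l)) \<omega> v \<subseteq> cube v l"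

definition escape_prob :: "nat \<Rightarrow> real" where
  "escape_prob l = Pr (escapes UNIV l 0)"

lemma escapes_depends: "depends_on (F \<inter> cube v (Suc l)) (escapes F l v)"
  unfolding depends_on_def escapes_def using cluster_in_cong[of "F \<inter> cube v (Suc l)"] by blast

lemma escapes_measurable: "event (escapes F l v) \<in> events"
  by (rule event_measurable[OF _ escapes_depends]) simp

lemma Pr_escapes: "Pr (escapes UNIV l v) = escape_prob l"
proof -
  have "escapes UNIV l v (translate v \<omega>) \<longleftrightarrow> escapes UNIV l 0 \<omega>" for \<omega>
    using cluster_in_translate[of v "cube 0 (Suc l)" \<omega> 0] cube_add[of v 0 "Suc l"] cube_add[of v 0 l]
    by (simp add: escapes_def inj_image_subset_iff)
  then show ?thesis
    using Pr_translate[OF escapes_measurable[of UNIV l v], of v] by (simp add: escape_prob_def)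
qed

lemma Pr_escapes_le: "Pr (escapes F l v) \<le> escape_prob l"
  unfolding Pr_escapes[of l v, symmetric]
proof (rule Pr_mono[OF escapes_measurable])
  fix \<omega> assume "escapes F l v \<omega>"
  then show "escapes UNIV l v \<omega>"
    unfolding escapes_def using cluster_in_mono[of "F \<inter> cube v (Suc l)" "UNIV \<inter> cube v (Suc l)" \<omega> v] by blast
qed

definition found :: "nat \<Rightarrow> 'n vertex set \<Rightarrow> 'n config \<Rightarrow> bool" where
  "found r A \<omega> \<longleftrightarrow> cluster_in (cube 0 (Suc r)) \<omega> 0 = A"

text \<open>Shapes found by exploring with states in \<open>cube 0 (Suc r)\<close> when the cluster
  leaves \<open>cube 0 r\<close>; the exploration may overshoot its box by one step, up to radius
  \<open>r + 2\<close>.\<close>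

definition exits :: "nat \<Rightarrow> 'n vertex set set" where
  "exits r = {A. A \<subseteq> cube 0 (r + 2) \<and> \<not> A \<subseteq> cube 0 r}"

definition exit_mass :: "nat \<Rightarrow> real" where
  "exit_mass r = (\<Sum>A\<in>exits r. real (card A) * Pr (found r A))"

lemma finite_exits: "finite (exits r)" "A \<in> exits r \<Longrightarrow> finite A"
proof -
  show "finite (exits r)"
    by (rule finite_subset[of _ "Pow (cube 0 (r + 2))"]) (auto simp: exits_def)
  show "A \<in> exits r \<Longrightarrow> finite A"
    using finite_subset[OF _ finite_cube] by (auto simp: exits_def)
qed

lemma found_depends: "depends_on (nbhd A) (found r A)"
  unfolding depends_on_def found_def using cluster_in_determined[where F = "cube 0 (Suc r)" and A = A] by blast

lemma found_measurable: "finite A \<Longrightarrow> event (found r A) \<in> events"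
  using event_measurable[OF finite_nbhd found_depends] .

text \<open>Explore first with states in \<open>cube 0 (Suc r)\<close>. To leave
  \<open>cube 0 l\<close>, an independent cluster restarted in \<open>thicken A\<close> must cover
  the remaining distance. A union bound over shapes and starting points brings in
  \<open>exit_mass r\<close>.\<close>

lemma escape_prob_step:
  assumes "l \<ge> r + 4"
  shows "escape_prob l \<le> real (card (cube (0 :: 'n vertex) 2)) * exit_mass r * escape_prob (l - (r + 4))"
proof -
  let ?l = "l - (r + 4)"
  let ?R = "\<lambda>(A, v) \<omega>. found r A \<omega> \<and> escapes (- nbhd A) ?l v \<omega>"
  let ?I = "SIGMA A:exits r. thicken A"
  have indep: "Pr (\<lambda>\<omega>. found r A \<omega> \<and> escapes (- nbhd A) ?l v \<omega>) \<le> Pr (found r A) * escape_prob ?l"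
    if "A \<in> exits r" for A v
  proof -
    have "Pr (\<lambda>\<omega>. found r A \<omega> \<and> escapes (- nbhd A) ?l v \<omega>) = Pr (found r A) * Pr (escapes (- nbhd A) ?l v)"
      by (rule Pr_indep[OF _ _ _ found_depends escapes_depends]) (use finite_exits(2)[OF that] in auto)
    also have "\<dots> \<le> Pr (found r A) * escape_prob ?l"
      by (intro mult_left_mono Pr_escapes_le) simp
    finally show ?thesis .
  qed
  have "escape_prob l \<le> (\<Sum>i\<in>?I. Pr (?R i))"
    unfolding escape_prob_def
  proof (rule Pr_le_sum)
    show "finite ?I" using finite_exits by auto
    fix i assume "i \<in> ?I"
    then obtain A v where i: "i = (A, v)" "finite A" using finite_exits(2) by auto
    show "event (?R i) \<in> events"
      unfolding i(1) prod.case
      by (rule event_measurable[of "nbhd A \<union> (- nbhd A \<inter> cube v (Suc ?l))"])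
        (use i(2) found_depends[of A r] escapes_depends[of "- nbhd A" v ?l]
          in \<open>auto intro!: depends_on_conj elim: depends_on_mono\<close>)
  next
    fix \<omega> assume leg: "legal \<omega>" and esc: "escapes UNIV l 0 \<omega>"
    let ?D = "cluster_in (cube 0 (Suc r)) \<omega> 0" and ?C = "cluster_in UNIV \<omega> 0"
    have C: "\<not> ?C \<subseteq> cube 0 l"
      using esc cluster_in_mono[of "UNIV \<inter> cube 0 (Suc l)" UNIV \<omega> 0] unfolding escapes_def by blast
    then have "\<not> ?C \<subseteq> cube 0 r" using cube_mono[of r l 0] assms by auto
    then have "\<not> ?D \<subseteq> cube 0 r" using not_in_cube_local[OF leg, of UNIV 0 r] by simp
    then have D: "?D \<in> exits r" using cluster_in_cube_subset[OF leg, of 0 "Suc r"] by (simp add: exits_def)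
    obtain y v where y: "y \<notin> cube 0 l" "v \<in> thicken ?D" "y \<in> cluster_in (- nbhd ?D) \<omega> v"
      using C cluster_subset_fresh[OF leg refl, where F = "cube 0 (Suc r)" and x = 0] by blast
    \<comment> \<open>The loss \<open>r + 4\<close> is the reach \<open>r + 2\<close> of the
      exploration plus 2 for \<open>thicken\<close>.\<close>
    have "v \<in> cube 0 (r + 4)"
    proof -
      obtain c where "c \<in> ?D" "v \<in> cube c 2" using y(2) by (auto simp: thicken_def)
      moreover have "?D \<subseteq> cube 0 (r + 2)" using D unfolding exits_def by blast
      ultimately have "v \<in> cube 0 (r + 2 + 2)" using cube_triangle[of c 0 "r + 2" v 2] by blast
      then show ?thesis by (simp add: eval_nat_numeral)
    qed
    then have "y \<notin> cube v ?l" using y(1) cube_triangle[of v 0 "r + 4" y ?l] assms by auto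
    then have "escapes (- nbhd ?D) ?l v \<omega>"
      unfolding escapes_def using not_in_cube_local[OF leg] y(3) by blast
    then show "\<exists>i\<in>?I. ?R i \<omega>"
      using D y(2) by (intro bexI[of _ "(?D, v)"]) (auto simp: found_def)
  qed
  also have "\<dots> = (\<Sum>A\<in>exits r. \<Sum>v\<in>thicken A. Pr (\<lambda>\<omega>. found r A \<omega> \<and> escapes (- nbhd A) ?l v \<omega>))"
    using finite_exits by (subst sum.Sigma) (auto simp: case_prod_unfold)
  also have "\<dots> \<le> (\<Sum>A\<in>exits r. \<Sum>v\<in>thicken A. Pr (found r A) * escape_prob ?l)"
    using indep by (intro sum_mono)
  also have "\<dots> \<le> (\<Sum>A\<in>exits r. real (card (cube (0 :: 'n vertex) 2)) * (real (card A) * Pr (found r A)) * escape_prob ?l)"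
  proof (rule sum_mono)
    fix A assume "A \<in> exits r"
    then have "real (card (thicken A)) \<le> real (card (cube (0 :: 'n vertex) 2)) * real (card A)"
      using card_thicken[OF finite_exits(2)] by (metis of_nat_le_iff of_nat_mult)
    then have "real (card (thicken A)) * (Pr (found r A) * escape_prob ?l)
        \<le> (real (card (cube (0 :: 'n vertex) 2)) * real (card A)) * (Pr (found r A) * escape_prob ?l)"
      by (intro mult_right_mono) (auto simp: escape_prob_def)
    then show "(\<Sum>v\<in>thicken A. Pr (found r A) * escape_prob ?l)
        \<le> real (card (cube (0 :: 'n vertex) 2)) * (real (card A) * Pr (found r A)) * escape_prob ?l"
      by (simp add: mult_ac)
  qed
  also have "\<dots> = real (card (cube (0 :: 'n vertex) 2)) * exit_mass r * escape_prob ?l"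
    by (simp add: exit_mass_def sum_distrib_left sum_distrib_right)
  finally show ?thesis .
qed

section \<open>A finite mean cluster size makes escapes exponentially unlikely\<close>

lemma measurable_cluster_size: "cluster_size \<in> measurable P (count_space UNIV)"
proof (subst measurable_count_space_eq2_countable)
  have fin: "cluster_size -` {enat n} \<inter> space P \<in> events" for n
  proof -
    have "cluster_size -` {enat n} \<inter> space P = event (\<lambda>\<omega>. cluster_size \<omega> = enat n)" by auto
    then show ?thesis using cluster_size_measurable by simp
  qed
  have "cluster_size -` {a} \<inter> space P \<in> events" for a
  proof (cases a)
    case (enat n)
    then show ?thesis using fin by simp
  next
    case infinity
    have "cluster_size -` {\<infinity>} \<inter> space P = space P - (\<Union>n. cluster_size -` {enat n} \<inter> space P)"
      by (auto; metis not_infinity_eq)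
    moreover have "\<dots> \<in> events" using fin by (intro sets.Diff sets.countable_UN) auto
    ultimately show ?thesis using infinity by simp
  qed
  then show "cluster_size \<in> space P \<rightarrow> UNIV \<and> (\<forall>a\<in>UNIV. cluster_size -` {a} \<inter> space P \<in> events)" by auto
qed

definition size_above :: "nat \<Rightarrow> 'n config \<Rightarrow> ennreal" where
  "size_above r \<omega> = (if cluster_size \<omega> > enat r then ennreal_of_enat (cluster_size \<omega>) else 0)"

lemma size_above_measurable: "size_above r \<in> borel_measurable P"
proof -
  have "(\<lambda>\<omega>. (\<lambda>c. if c > enat r then ennreal_of_enat c else 0) (cluster_size \<omega>)) \<in> borel_measurable P"
    by (rule measurable_compose[OF measurable_cluster_size]) simp
  then show ?thesis by (simp add: size_above_def[abs_def])
qed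

text \<open>The shapes exclude each other, so \<open>exit_mass r\<close> is the mean size of the
  explored part on the event of exit. That part lies in the full cluster, which then has more than
  \<open>r\<close> vertices.\<close>

lemma exit_mass_le: "ennreal (exit_mass r) \<le> (\<integral>\<^sup>+ \<omega>. size_above r \<omega> \<partial>P)"
proof -
  have "ennreal (exit_mass r) = (\<Sum>A\<in>exits r. of_nat (card A) * emeasure P (event (found r A)))"
    unfolding exit_mass_def by (subst sum_ennreal[symmetric])
      (auto simp: ennreal_mult emeasure_eq_measure ennreal_of_nat_eq_real_of_nat intro!: sum.cong)
  also have "\<dots> = (\<Sum>A\<in>exits r. \<integral>\<^sup>+ \<omega>. of_nat (card A) * indicator (event (found r A)) \<omega> \<partial>P)"
    using found_measurable finite_exits by (intro sum.cong refl nn_integral_cmult_indicator[symmetric]) auto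
  also have "\<dots> = (\<integral>\<^sup>+ \<omega>. (\<Sum>A\<in>exits r. of_nat (card A) * indicator (event (found r A)) \<omega>) \<partial>P)"
    using found_measurable finite_exits by (intro nn_integral_sum[symmetric]) auto
  also have "\<dots> \<le> (\<integral>\<^sup>+ \<omega>. size_above r \<omega> \<partial>P)"
  proof (rule nn_integral_mono)
    fix \<omega> assume w: "\<omega> \<in> space P"
    then have leg: "legal \<omega>" by (simp add: space_P)
    let ?D = "cluster_in (cube 0 (Suc r)) \<omega> 0" and ?C = "cluster_in UNIV \<omega> 0"
    have "(\<Sum>A\<in>exits r. of_nat (card A) * indicator (event (found r A)) \<omega>)
        = (\<Sum>A\<in>exits r. if A = ?D then of_nat (card ?D) else (0::ennreal))"
      using w by (intro sum.cong refl) (auto simp: found_def indicator_def)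
    also have "\<dots> = (if ?D \<in> exits r then of_nat (card ?D) else 0)"
      using finite_exits(1) by simp
    also have "\<dots> \<le> size_above r \<omega>"
    proof (cases "?D \<in> exits r \<and> finite ?C")
      case True
      have sub: "?D \<subseteq> ?C" by (rule cluster_in_mono) simp
      then have "\<not> ?C \<subseteq> cube 0 r" using True by (auto simp: exits_def)
      then have "card ?C > r" using card_cluster_ge[OF leg, of UNIV 0 r] True by auto
      moreover have "card ?D \<le> card ?C" using sub True by (intro card_mono) auto
      ultimately show ?thesis
        using True by (simp add: size_above_def cluster_size_def origin_cluster_eq)
    next
      case False
      then show ?thesis
        by (auto simp: size_above_def cluster_size_def origin_cluster_eq)
    qed
    finally show "(\<Sum>A\<in>exits r. of_nat (card A) * indicator (event (found r A)) \<omega>) \<le> size_above r \<omega>" .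
  qed
  finally show ?thesis .
qed

text \<open>A finite mean makes the cluster almost surely finite, so \<open>size_above r\<close>
  tends to 0 almost surely; dominated convergence with the cluster size as majorant
  concludes.\<close>

lemma exit_mass_small:
  assumes "(\<integral>\<^sup>+ \<omega>. ennreal_of_enat (cluster_size \<omega>) \<partial>P) < \<infinity>" and "e > 0"
  shows "\<exists>r. exit_mass r \<le> e"
proof -
  have meas: "(\<lambda>\<omega>. ennreal_of_enat (cluster_size \<omega>)) \<in> borel_measurable P"
    by (rule measurable_compose[OF measurable_cluster_size]) simp
  have "AE \<omega> in P. ennreal_of_enat (cluster_size \<omega>) \<noteq> \<infinity>"
    using assms(1) by (intro nn_integral_noteq_infinite meas) auto
  then have ptw: "AE \<omega> in P. (\<lambda>r. size_above r \<omega>) \<longlonglongrightarrow> 0"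
  proof eventually_elim
    case (elim \<omega>)
    then obtain n where n: "cluster_size \<omega> = enat n" by (cases "cluster_size \<omega>") auto
    have "\<forall>\<^sub>F r in sequentially. size_above r \<omega> = 0"
      using eventually_ge_at_top[of n] by eventually_elim (simp add: size_above_def n)
    then show ?case by (rule tendsto_eventually)
  qed
  have le: "size_above r \<omega> \<le> ennreal_of_enat (cluster_size \<omega>)" for r \<omega>
    by (simp add: size_above_def)
  have "(\<lambda>r. \<integral>\<^sup>+ \<omega>. size_above r \<omega> \<partial>P) \<longlonglongrightarrow> (\<integral>\<^sup>+ \<omega>. 0 \<partial>P)"
    by (rule nn_integral_dominated_convergence[where w = "\<lambda>\<omega>. ennreal_of_enat (cluster_size \<omega>)"])
      (use assms(1) meas size_above_measurable ptw le in auto)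
  then have "\<forall>\<^sub>F r in sequentially. (\<integral>\<^sup>+ \<omega>. size_above r \<omega> \<partial>P) < ennreal e"
    using assms(2) by (auto dest: order_tendstoD(2)[of _ _ _ "ennreal e"])
  then obtain r where "(\<integral>\<^sup>+ \<omega>. size_above r \<omega> \<partial>P) < ennreal e"
    by (auto simp: eventually_sequentially)
  then have "ennreal (exit_mass r) \<le> ennreal e" using exit_mass_le[of r] by (meson less_imp_le order_trans)
  then show ?thesis using assms(2) by (auto simp: ennreal_le_iff)
qed

text \<open>Choose \<open>r\<close> so that the factor in \<open>escape_prob_step\<close> is at most
  1/2; then each additional distance \<open>r + 4\<close> halves the bound.\<close>

lemma escape_prob_decay:
  assumes "(\<integral>\<^sup>+ \<omega>. ennreal_of_enat (cluster_size \<omega>) \<partial>P) < \<infinity>"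
  shows "\<exists>s\<ge>1. \<forall>j. escape_prob (j * s) \<le> (1 / 2) ^ j"
proof -
  let ?K = "real (card (cube (0 :: 'n vertex) 2))"
  have "cube (0 :: 'n vertex) 2 \<noteq> {}" using cube_self[of 0 2] by blast
  then have K: "?K > 0" by (simp add: card_gt_0_iff)
  then obtain r where r: "exit_mass r \<le> 1 / (2 * ?K)" using exit_mass_small[OF assms, of "1 / (2 * ?K)"] by auto
  have half: "?K * exit_mass r \<le> 1 / 2" using r K by (simp add: field_simps)
  have "escape_prob (j * (r + 4)) \<le> (1 / 2) ^ j" for j
  proof (induction j)
    case 0
    show ?case by (simp add: escape_prob_def)
  next
    case (Suc j)
    have "escape_prob (Suc j * (r + 4)) \<le> ?K * exit_mass r * escape_prob (j * (r + 4))"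
      using escape_prob_step[of r "Suc j * (r + 4)"] by simp
    also have "\<dots> \<le> 1 / 2 * (1 / 2) ^ j"
      using half Suc by (intro mult_mono) (auto simp: escape_prob_def)
    finally show ?case by simp
  qed
  then show ?thesis by (intro exI[of _ "r + 4"]) auto
qed

text \<open>A cluster with more vertices than \<open>cube 0 L\<close> escapes from each of its
  vertices. A walk of \<open>2 * k\<close> steps visits \<open>k + 1\<close> of them with disjoint
  windows, where the escapes are independent; sum over all walks.\<close>

lemma size_prob_walk_bound:
  assumes n: "n > card (cube (0 :: 'n vertex) L)" and k: "k * card (cube (0 :: 'n vertex) (2 * L + 2)) < n"
  shows "size_prob n \<le> real (card (cube (0 :: 'n vertex) (2 * L + 3))) ^ (2 * k) * escape_prob L ^ Suc k"
proof -
  \<comment> \<open>Escapes are decided within radius \<open>Suc L\<close>, so windows whose centres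
    are further than \<open>2 * L + 2\<close> apart are disjoint.\<close>
  let ?R = "2 * L + 2"
  let ?B = "cube (0 :: 'n vertex) (Suc ?R)"
  define I where "I = {ts. set ts \<subseteq> ?B \<and> length ts = 2 * k \<and> card (visited 0 ts) = Suc k \<and> separated ?R (visited 0 ts)}"
  have finI: "finite I" and cardI: "card I \<le> card ?B ^ (2 * k)"
  proof -
    have sub: "I \<subseteq> {ts. set ts \<subseteq> ?B \<and> length ts = 2 * k}" by (auto simp: I_def)
    have f: "finite {ts. set ts \<subseteq> ?B \<and> length ts = 2 * k}" by (rule finite_lists_length_eq) simp
    show "finite I" using sub f by (rule finite_subset)
    show "card I \<le> card ?B ^ (2 * k)"
      using card_mono[OF f sub] by (simp add: card_lists_length_eq)
  qed
  have each: "Pr (\<lambda>\<omega>. \<forall>s\<in>visited 0 ts. escapes UNIV L s \<omega>) = escape_prob L ^ Suc k" if "ts \<in> I" for ts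
  proof -
    have "disjoint_family_on (\<lambda>s. UNIV \<inter> cube s (Suc L)) (visited 0 ts)"
      unfolding disjoint_family_on_def
    proof (intro ballI impI)
      fix s t assume st: "s \<in> visited 0 ts" "t \<in> visited 0 ts" "s \<noteq> t"
      show "UNIV \<inter> cube s (Suc L) \<inter> (UNIV \<inter> cube t (Suc L)) = {}"
      proof (rule ccontr)
        assume "UNIV \<inter> cube s (Suc L) \<inter> (UNIV \<inter> cube t (Suc L)) \<noteq> {}"
        then obtain z where "z \<in> cube s (Suc L)" "z \<in> cube t (Suc L)" by auto
        then have "t \<in> cube s (Suc L + Suc L)" using cube_triangle[of z s "Suc L" t "Suc L"] cube_sym[of z t] by blast
        then have "t \<in> cube s ?R" by (simp add: mult_2)
        then show False using st that unfolding I_def separated_def by blast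
      qed
    qed
    then have "Pr (\<lambda>\<omega>. \<forall>s\<in>visited 0 ts. escapes UNIV L s \<omega>) = (\<Prod>s\<in>visited 0 ts. Pr (escapes UNIV L s))"
      by (intro Pr_indep_family[where I = "\<lambda>s. UNIV \<inter> cube s (Suc L)"] escapes_depends) auto
    also have "\<dots> = escape_prob L ^ card (visited 0 ts)" by (simp only: Pr_escapes prod_constant)
    finally show ?thesis using that by (simp add: I_def)
  qed
  have "size_prob n \<le> (\<Sum>ts\<in>I. Pr (\<lambda>\<omega>. \<forall>s\<in>visited 0 ts. escapes UNIV L s \<omega>))"
    unfolding size_prob_def
  proof (rule Pr_le_sum[OF finI])
    fix ts assume "ts \<in> I"
    have "event (\<lambda>\<omega>. \<forall>s\<in>visited 0 ts. escapes UNIV L s \<omega>) = (\<Inter>s\<in>visited 0 ts. event (escapes UNIV L s))"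
      using visited_start[of 0 ts] by auto
    then show "event (\<lambda>\<omega>. \<forall>s\<in>visited 0 ts. escapes UNIV L s \<omega>) \<in> events"
      using visited_start[of 0 ts] escapes_measurable by (auto intro!: sets.finite_INT)
  next
    fix \<omega> :: "'n config" assume leg: "legal \<omega>" and size: "cluster_size \<omega> = enat n"
    let ?C = "cluster_in UNIV \<omega> 0"
    have C: "finite ?C" "card ?C = n" using size by (auto simp: cluster_size_eq origin_cluster_eq)
    obtain ts where ts: "length ts = 2 * k" "set ts \<subseteq> ?B" "visited 0 ts \<subseteq> ?C"
      "card (visited 0 ts) = Suc k" "separated ?R (visited 0 ts)"
      using walk_through_cluster[OF leg refl, of k ?R 0] k C(2) by auto
    have "escapes UNIV L s \<omega>" if "s \<in> visited 0 ts" for s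
    proof -
      have eq: "cluster_in UNIV \<omega> s = ?C" using ts(3) that cluster_in_eq by blast
      have "\<not> ?C \<subseteq> cube s L"
        using card_mono[of "cube s L" ?C] n C(2) by (auto simp: card_cube_eq[of s])
      then show ?thesis
        using not_in_cube_local[OF leg, of UNIV s L] eq by (simp add: escapes_def)
    qed
    then show "\<exists>ts\<in>I. \<forall>s\<in>visited 0 ts. escapes UNIV L s \<omega>"
      using ts by (intro bexI[of _ ts]) (auto simp: I_def)
  qed
  also have "\<dots> = real (card I) * escape_prob L ^ Suc k" using each by simp
  also have "\<dots> \<le> real (card ?B ^ (2 * k)) * escape_prob L ^ Suc k"
    using cardI by (intro mult_right_mono) (auto simp: escape_prob_def simp del: of_nat_power)
  also have "\<dots> = real (card (cube (0 :: 'n vertex) (2 * L + 3))) ^ (2 * k) * escape_prob L ^ Suc k"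
    by (simp add: eval_nat_numeral)
  finally show ?thesis .
qed

text \<open>At scale \<open>L = j * s\<close> the squared volume is polynomial in \<open>j\<close>,
  whereas the escape probability is at most \<open>(1 / 2) ^ j\<close>. The square is there because
  each escape costs two walk steps.\<close>

lemma escape_prob_beats_volume:
  assumes "(\<integral>\<^sup>+ \<omega>. ennreal_of_enat (cluster_size \<omega>) \<partial>P) < \<infinity>"
  shows "\<exists>L. real (card (cube (0 :: 'n vertex) (2 * L + 3))) ^ 2 * escape_prob L \<le> 1 / 2"
proof -
  obtain s where s: "s \<ge> 1" "\<And>j. escape_prob (j * s) \<le> (1 / 2) ^ j" using escape_prob_decay[OF assms] by auto
  define m where "m = 2 * CARD('n)"
  have "filterlim (\<lambda>j. ln 2 * real j) at_top sequentially"
    by (rule filterlim_tendsto_pos_mult_at_top[OF tendsto_const _ filterlim_real_sequentially]) simp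
  then have "(\<lambda>j. (ln 2 * real j) ^ m / exp (ln 2 * real j)) \<longlonglongrightarrow> 0"
    by (rule filterlim_compose[OF tendsto_power_div_exp_0])
  then have "(\<lambda>j. (11 * real s / ln 2) ^ m * ((ln 2 * real j) ^ m / exp (ln 2 * real j))) \<longlonglongrightarrow> 0"
    by (rule tendsto_mult_right_zero)
  then have "\<forall>\<^sub>F j in sequentially. (11 * real s / ln 2) ^ m * ((ln 2 * real j) ^ m / exp (ln 2 * real j)) < 1 / 2"
    by (rule order_tendstoD(2)) simp
  moreover have "\<forall>\<^sub>F j in sequentially. j \<ge> (1::nat)" by (rule eventually_ge_at_top)
  ultimately have "\<forall>\<^sub>F j in sequentially. j \<ge> 1 \<and> (11 * real s / ln 2) ^ m * ((ln 2 * real j) ^ m / exp (ln 2 * real j)) < 1 / 2"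
    by eventually_elim simp
  then obtain j :: nat where j: "j \<ge> 1" "(11 * real s / ln 2) ^ m * ((ln 2 * real j) ^ m / exp (ln 2 * real j)) < 1 / 2"
    by (auto simp: eventually_sequentially)
  define L where "L = j * s"
  have L: "L \<ge> 1" using j s by (simp add: L_def)
  have "card (cube (0 :: 'n vertex) (2 * L + 3)) \<le> (2 * (2 * L + 3) + 1) ^ CARD('n)" using card_cube_le by blast
  \<comment> \<open>Here \<open>2 * (2 * L + 3) + 1 = 4 * L + 7\<close>, which is at most
    \<open>11 * L\<close> as \<open>L >= 1\<close>.\<close>
  also have "\<dots> \<le> (11 * L) ^ CARD('n)" using L by (intro power_mono) auto
  finally have "real (card (cube (0 :: 'n vertex) (2 * L + 3))) \<le> (11 * real L) ^ CARD('n)"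
    by (metis of_nat_le_iff of_nat_mult of_nat_numeral of_nat_power)
  then have "real (card (cube (0 :: 'n vertex) (2 * L + 3))) ^ 2 \<le> ((11 * real L) ^ CARD('n)) ^ 2"
    by (intro power_mono) auto
  then have vol: "real (card (cube (0 :: 'n vertex) (2 * L + 3))) ^ 2 \<le> (11 * real L) ^ m"
    by (simp only: m_def mult.commute[of 2 "CARD('n)"] power_mult)
  have "real (card (cube (0 :: 'n vertex) (2 * L + 3))) ^ 2 * escape_prob L \<le> (11 * real L) ^ m * (1 / 2) ^ j"
    using vol s(2)[of j] by (intro mult_mono) (auto simp: L_def escape_prob_def)
  also have "\<dots> = (11 * real s / ln 2) ^ m * ((ln 2 * real j) ^ m / exp (ln 2 * real j))"
  proof -
    have "exp (ln 2 * real j) = 2 ^ j" by (simp add: exp_of_nat2_mult)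
    then show ?thesis by (simp add: L_def power_mult_distrib power_divide power_one_over field_simps)
  qed
  finally show ?thesis using j(2) by (intro exI[of _ L]) linarith
qed

lemma size_prob_exponential:
  assumes "(\<integral>\<^sup>+ \<omega>. ennreal_of_enat (cluster_size \<omega>) \<partial>P) < \<infinity>"
  shows "\<exists>\<delta>>0. \<exists>N. \<forall>n\<ge>N. size_prob n \<le> exp (- \<delta> * real n)"
proof -
  obtain L where L: "real (card (cube (0 :: 'n vertex) (2 * L + 3))) ^ 2 * escape_prob L \<le> 1 / 2"
    using escape_prob_beats_volume[OF assms] by blast
  define B where "B = card (cube (0 :: 'n vertex) (2 * L + 2))"
  define V where "V = real (card (cube (0 :: 'n vertex) (2 * L + 3)))"
  have ne: "cube (0 :: 'n vertex) r \<noteq> {}" for r using cube_self[of 0 r] by blast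
  have B: "B > 0" using ne by (simp add: B_def card_gt_0_iff)
  have V: "V \<ge> 1" using ne by (simp add: V_def Suc_le_eq card_gt_0_iff)
  have e0: "escape_prob L \<ge> 0" by (simp add: escape_prob_def)
  have "size_prob n \<le> exp (- (ln 2 / real B) * real n)" if n: "n \<ge> Suc (card (cube (0 :: 'n vertex) L))" for n
  proof -
    \<comment> \<open>The largest \<open>k\<close> with \<open>k * B < n\<close>, as
      \<open>size_prob_walk_bound\<close> requires.\<close>
    define k where "k = (n - 1) div B"
    have "k * B \<le> n - 1" by (simp add: k_def)
    then have "size_prob n \<le> V ^ (2 * k) * escape_prob L ^ Suc k"
      unfolding V_def using n by (intro size_prob_walk_bound) (auto simp: B_def)
    \<comment> \<open>Two surplus volume factors make the bound a pure power with exponent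
      \<open>Suc k\<close>.\<close>
    also have "\<dots> \<le> V ^ (2 * Suc k) * escape_prob L ^ Suc k"
      using V e0 by (intro mult_right_mono power_increasing) auto
    also have "\<dots> = (V ^ 2 * escape_prob L) ^ Suc k"
      by (simp only: power_mult_distrib power_mult)
    also have "\<dots> \<le> (1 / 2) ^ Suc k"
      using L e0 by (intro power_mono) (auto simp: V_def)
    also have "\<dots> = exp (- ln 2 * real (Suc k))"
    proof -
      have "exp (- ln 2 * real (Suc k)) = exp (- ln (2::real)) ^ Suc k" by (rule exp_of_nat2_mult)
      also have "exp (- ln (2::real)) = 1 / 2" by (simp add: exp_minus)
      finally show ?thesis ..
    qed
    also have "\<dots> \<le> exp (- (ln 2 / real B) * real n)"
    proof -
      have "n - 1 < B + k * B" unfolding k_def by (rule dividend_less_div_times[OF B])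
      then have "n \<le> Suc k * B" by simp
      then have "real n \<le> real (Suc k) * real B" by (metis of_nat_le_iff of_nat_mult)
      then have "ln 2 * real n \<le> ln 2 * (real (Suc k) * real B)" by (intro mult_left_mono) auto
      then show ?thesis using B by (simp add: field_simps)
    qed
    finally show ?thesis .
  qed
  moreover have "ln 2 / real B > 0" using B by simp
  ultimately show ?thesis by blast
qed

text \<open>\<open>a_const d p\<close> is \<open>link 2\<close> times the extra factor
  \<open>weight 2 * avoid 1 ^ (d - 4)\<close>, which is at most 1.\<close>

lemma a_const_bounds: "0 < a_const d p" "a_const d p \<le> link 2"
proof -
  have a: "a_const d p = weight 2 ^ 3 * avoid 2 ^ (2 * d - 4) * avoid 1 ^ (d - 4)"
    by (simp only: a_const_def avoid_1[symmetric] avoid_2[symmetric] weight_2[symmetric])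
  have a1: "0 < avoid 1" "avoid 1 \<le> 1"
    using avoid_antimono[of 1 2] avoid_2_pos avoid_le_1[of 1] d_ge by auto
  show "0 < a_const d p"
    unfolding a using weight_2_pos avoid_2_pos a1 by simp
  have "a_const d p = link 2 * (weight 2 * avoid 1 ^ (d - 4))"
    by (simp add: a link_def power3_eq_cube power2_eq_square diff_mult_distrib2 mult_ac)
  also have "\<dots> \<le> link 2 * 1"
    using link_pos[of 2] weight_2_pos weight_2_le_1 a1
    by (intro mult_left_mono mult_le_one power_le_one) auto
  finally show "a_const d p \<le> link 2" by simp
qed

end

theorem theorem24:
  fixes p :: "nat \<Rightarrow> real" and d :: nat
  assumes d_def: "d = lattice_degree TYPE('n::finite)"
    and dim: "CARD('n) \<ge> 2"
    and p_nonneg: "\<And>i. i \<le> d \<Longrightarrow> p i \<ge> 0"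
    and p_sum: "(\<Sum>i=0..d. p i) = 1"
    and p2_pos: "p 2 > 0"
  shows "\<exists>\<zeta>::real. \<zeta> \<ge> 0
    \<and> ((\<lambda>n. neg_log (cluster_size_prob TYPE('n) p n) / ereal (real n)) \<longlonglongrightarrow> ereal \<zeta>)
    \<and> (mean_cluster_size TYPE('n) p < \<infinity> \<longrightarrow> \<zeta> > 0)
    \<and> (\<forall>n\<ge>1. cluster_size_prob TYPE('n) p n \<le> real n / a_const d p * exp (- real n * \<zeta>))"
proof -
  interpret degenerate_environment p d "TYPE('n)"
    by unfold_locales (use assms in auto)
  have size: "cluster_size_prob TYPE('n) p n = size_prob n" for n
    by (simp add: cluster_size_prob_def size_prob_def)
  obtain \<zeta> where z: "\<zeta> \<ge> 0" "(\<lambda>n. - ln (size_prob n) / real n) \<longlonglongrightarrow> \<zeta>"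
    "\<And>n. n \<ge> 1 \<Longrightarrow> size_prob n \<le> real n / link 2 * exp (- real n * \<zeta>)"
    using size_prob_limit by blast
  \<comment> \<open>From size 10 on the probabilities are positive, so \<open>neg_log\<close> is
    eventually a real logarithm and never takes its infinite value.\<close>
  have "(\<lambda>n. neg_log (size_prob n) / ereal (real n)) \<longlonglongrightarrow> ereal \<zeta>"
  proof (rule Lim_transform_eventually)
    show "(\<lambda>n. ereal (- ln (size_prob n) / real n)) \<longlonglongrightarrow> ereal \<zeta>"
      using z(2) by (intro tendsto_intros)
    show "\<forall>\<^sub>F n in sequentially. ereal (- ln (size_prob n) / real n) = neg_log (size_prob n) / ereal (real n)"
      using eventually_ge_at_top[of 10]
    proof eventually_elim
      case (elim n)
      then show ?case using size_prob_pos[of n] by (simp add: neg_log_def)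
    qed
  qed
  moreover have "\<zeta> > 0" if "mean_cluster_size TYPE('n) p < \<infinity>"
  proof -
    have "\<exists>\<delta>>0. \<exists>N. \<forall>n\<ge>N. size_prob n \<le> exp (- \<delta> * real n)"
      by (rule size_prob_exponential) (use that in \<open>simp add: mean_cluster_size_def\<close>)
    then obtain \<delta> N where dN: "\<delta> > 0" "\<And>n. n \<ge> N \<Longrightarrow> size_prob n \<le> exp (- \<delta> * real n)"
      by blast
    \<comment> \<open>Exponential decay at rate \<open>\<delta>\<close> bounds the sequence below
      eventually, and the bound passes to its limit.\<close>
    have "\<delta> \<le> - ln (size_prob n) / real n" if n: "n \<ge> max N 10" for n
    proof -
      have "ln (size_prob n) \<le> ln (exp (- \<delta> * real n))"
        using dN(2)[of n] size_prob_pos[of n] n by (intro ln_mono) auto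
      then show ?thesis using n by (simp add: field_simps)
    qed
    then have "\<delta> \<le> \<zeta>" by (intro LIMSEQ_le_const[OF z(2)]) blast
    then show ?thesis using dN(1) by linarith
  qed
  moreover have "size_prob n \<le> real n / a_const d p * exp (- real n * \<zeta>)" if "n \<ge> 1" for n
  proof -
    have "real n / link 2 \<le> real n / a_const d p"
      using a_const_bounds by (intro divide_left_mono) auto
    then have "real n / link 2 * exp (- real n * \<zeta>) \<le> real n / a_const d p * exp (- real n * \<zeta>)"
      by (intro mult_right_mono) auto
    then show ?thesis using z(3)[OF that] by linarith
  qed
  ultimately show ?thesis using z(1) unfolding size by blast
qed

end
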